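(* Let $(M,\omega)$ be a closed symplectic manifold, and let $\rho$ denote the Hofer norm on $\mathrm{Ham}(M,\omega)$. Assume that there exists some $\phi\in \mathrm{Symp}_0(M,\omega)$ which is unbounded, i.e. $\sup\{\rho(\phi f\phi^{-1}f^{-1}) \mid f\in \mathrm{Ham}(M,\omega)\}=\infty$. Then the Hofer metric on $\mathrm{Ham}(M,\omega)$ does not extend to a bi-invariant metric on $\mathrm{Symp}_0(M,\omega)$.
   Context: $\mathrm{Symp}_0(M,\omega)$ is the identity component of the group $\mathrm{Symp}(M,\omega)$ of symplectomorphisms, and $\mathrm{Ham}(M,\omega)\subset \mathrm{Symp}_0(M,\omega)$ is the (normal) subgroup of Hamiltonian symplectomorphisms, i.e. time-1 maps of flows of time-dependent smooth Hamiltonian functions. Hofer metric: let $\dim M=2n$ and let $\mathcal A$ be the space of smooth functions $F$ on $M$ with $\int_M F\,\omega^n=0$. The Hofer length of a smooth path in $\mathrm{Ham}(M,\omega)$ generated by $F_t\in\mathcal A$, $t\in[0,1]$, is $\int_0^1\|F_t\|_\infty\,dt$, where $\|F\|_\infty=\max_M|F|$. The Hofer distance $d(f,g)$ is the infimum of lengths of smooth paths in $\mathrm{Ham}(M,\omega)$ connecting $f$ and $g$; it is a bi-invariant metric. The Hofer norm is $\rho(f)=d(id,f)$. A (real-valued) metric $d$ on a group $G$ is bi-invariant if $d(\theta\phi,\theta\psi)=d(\phi\theta,\psi\theta)=d(\phi,\psi)$ for all $\phi,\psi,\theta\in G$. A metric on $\mathrm{Ham}(M,\omega)$ extends to a bi-invariant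 metric on $\mathrm{Symp}_0(M,\omega)$ if it is the restriction of a bi-invariant metric on $\mathrm{Symp}_0(M,\omega)$. Since $\mathrm{Ham}(M,\omega)$ is normal, $\phi f\phi^{-1}f^{-1}\in \mathrm{Ham}(M,\omega)$ for $\phi\in \mathrm{Symp}_0(M,\omega)$ and $f\in \mathrm{Ham}(M,\omega)$. *)

theory Defs
  imports "HOL-Analysis.Analysis"
begin

section \<open>Smooth functions between Euclidean spaces\<close>

text \<open>Iterated directional derivatives: the head of the list is the direction of the last
  differentiation. On an open set, a function is $C^\infty$ iff all of these are (Frechet)
  differentiable.\<close>

primrec iter_dderiv ::
  "'a list \<Rightarrow> ('a::euclidean_space \<Rightarrow> 'b::euclidean_space) \<Rightarrow> 'a \<Rightarrow> 'b" where
  "iter_dderiv [] f = f"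
| "iter_dderiv (v # vs) f = (\<lambda>x. frechet_derivative (iter_dderiv vs f) (at x) v)"

definition smooth_open :: "'a::euclidean_space set \<Rightarrow> ('a \<Rightarrow> 'b::euclidean_space) \<Rightarrow> bool" where
  "smooth_open W f \<longleftrightarrow> open W \<and> (\<forall>vs. \<forall>x\<in>W. iter_dderiv vs f differentiable (at x))"

text \<open>Smoothness on an arbitrary subset, needed for sets such as $[0,1]\times V$: locally the
  restriction of a smooth function on an open set.\<close>

definition smooth_on :: "'a::euclidean_space set \<Rightarrow> ('a \<Rightarrow> 'b::euclidean_space) \<Rightarrow> bool" where
  "smooth_on S f \<longleftrightarrow>
     (\<forall>x\<in>S. \<exists>W g. x \<in> W \<and> smooth_open W g \<and> (\<forall>y\<in>S \<inter> W. f y = g y))"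


section \<open>Manifolds\<close>

text \<open>The manifold is the whole type \<open>'m\<close>, the model space is \<open>'e\<close>. A chart is a pair of its
  domain and a coordinate map; the values of the map off the domain are irrelevant.\<close>

type_synonym ('m, 'e) chart = "'m set \<times> ('m \<Rightarrow> 'e)"

abbreviation cdom :: "('m, 'e) chart \<Rightarrow> 'm set" where "cdom \<equiv> fst"
abbreviation cmap :: "('m, 'e) chart \<Rightarrow> 'm \<Rightarrow> 'e" where "cmap \<equiv> snd"

definition cimg :: "('m, 'e) chart \<Rightarrow> 'e set" where
  "cimg c = cmap c ` cdom c"

definition cinv :: "('m, 'e) chart \<Rightarrow> 'e \<Rightarrow> 'm" where
  "cinv c = inv_into (cdom c) (cmap c)"

definition is_chart ::
  "('m::{t2_space, second_countable_topology}, 'e::euclidean_space) chart \<Rightarrow> bool" where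
  "is_chart c \<longleftrightarrow> open (cdom c) \<and> open (cimg c) \<and>
     homeomorphism (cdom c) (cimg c) (cmap c) (cinv c)"

definition smooth_atlas ::
  "('m::{t2_space, second_countable_topology}, 'e::euclidean_space) chart set \<Rightarrow> bool" where
  "smooth_atlas A \<longleftrightarrow> (\<forall>c\<in>A. is_chart c) \<and> (\<Union>c\<in>A. cdom c) = UNIV \<and>
     (\<forall>c\<in>A. \<forall>d\<in>A. smooth_on (cmap c ` (cdom c \<inter> cdom d)) (cmap d \<circ> cinv c))"

definition smooth_fun :: "('m, 'e::euclidean_space) chart set \<Rightarrow> ('m \<Rightarrow> real) \<Rightarrow> bool" where
  "smooth_fun A F \<longleftrightarrow> (\<forall>c\<in>A. smooth_on (cimg c) (F \<circ> cinv c))"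

definition smooth_map ::
  "('m::topological_space, 'e::euclidean_space) chart set \<Rightarrow> ('m \<Rightarrow> 'm) \<Rightarrow> bool" where
  "smooth_map A f \<longleftrightarrow> continuous_on UNIV f \<and>
     (\<forall>c\<in>A. \<forall>d\<in>A. smooth_on (cmap c ` (cdom c \<inter> f -` cdom d)) (cmap d \<circ> f \<circ> cinv c))"

text \<open>Smooth maps $[0,1]\times M\to\mathbb R$ and $[0,1]\times M\to M$; values at times outside
  $[0,1]$ are irrelevant.\<close>

definition smooth_fun_family ::
  "('m, 'e::euclidean_space) chart set \<Rightarrow> (real \<Rightarrow> 'm \<Rightarrow> real) \<Rightarrow> bool" where
  "smooth_fun_family A F \<longleftrightarrow>
     (\<forall>c\<in>A. smooth_on ({0..1} \<times> cimg c) (\<lambda>(t, y). F t (cinv c y)))"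

definition smooth_map_family ::
  "('m::topological_space, 'e::euclidean_space) chart set \<Rightarrow> (real \<Rightarrow> 'm \<Rightarrow> 'm) \<Rightarrow> bool" where
  "smooth_map_family A h \<longleftrightarrow>
     continuous_on ({0..1} \<times> UNIV) (\<lambda>(t, x). h t x) \<and>
     (\<forall>c\<in>A. \<forall>d\<in>A.
        smooth_on {(t, y). t \<in> {0..1} \<and> y \<in> cimg c \<and> h t (cinv c y) \<in> cdom d}
          (\<lambda>(t, y). cmap d (h t (cinv c y))))"


section \<open>Symplectic forms\<close>

text \<open>A differential 2-form is given by its local expressions: \<open>\<omega> c y u v\<close> is the value, in the
  chart \<open>c\<close> and at the point with coordinates \<open>y\<close>, on the tangent vectors with components
  \<open>u\<close> and \<open>v\<close>.\<close>

type_synonym ('m, 'e) local_2form = "('m, 'e) chart \<Rightarrow> 'e \<Rightarrow> 'e \<Rightarrow> 'e \<Rightarrow> real"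

definition two_form ::
  "('m, 'e::euclidean_space) chart set \<Rightarrow> ('m, 'e) local_2form \<Rightarrow> bool" where
  "two_form A \<omega> \<longleftrightarrow>
     (\<forall>c\<in>A. \<forall>y\<in>cimg c. bilinear (\<omega> c y) \<and> (\<forall>u. \<omega> c y u u = 0)) \<and>
     (\<forall>c\<in>A. \<forall>u v. smooth_on (cimg c) (\<lambda>y. \<omega> c y u v)) \<and>
     (\<forall>c\<in>A. \<forall>d\<in>A. \<forall>x\<in>cdom c \<inter> cdom d. \<forall>u v.
        (let D = frechet_derivative (cmap d \<circ> cinv c) (at (cmap c x))
         in \<omega> c (cmap c x) u v = \<omega> d (cmap d x) (D u) (D v)))"

definition ext_deriv2 ::
  "('m, 'e::euclidean_space) local_2form \<Rightarrow> ('m, 'e) chart \<Rightarrow> 'e \<Rightarrow> 'e \<Rightarrow> 'e \<Rightarrow> 'e \<Rightarrow> real" where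
  "ext_deriv2 \<omega> c y u v w =
     frechet_derivative (\<lambda>z. \<omega> c z v w) (at y) u
   - frechet_derivative (\<lambda>z. \<omega> c z u w) (at y) v
   + frechet_derivative (\<lambda>z. \<omega> c z u v) (at y) w"

text \<open>Closed means compact; charts onto open sets of \<open>'e\<close> already exclude a boundary. That
  \<open>DIM('e)\<close> is even follows from nondegeneracy.\<close>

definition closed_symplectic_manifold ::
  "('m::{t2_space, second_countable_topology}, 'e::euclidean_space) chart set \<Rightarrow>
   ('m, 'e) local_2form \<Rightarrow> bool" where
  "closed_symplectic_manifold A \<omega> \<longleftrightarrow>
     compact (UNIV :: 'm set) \<and> smooth_atlas A \<and> two_form A \<omega> \<and>
     (\<forall>c\<in>A. \<forall>y\<in>cimg c. \<forall>u v w. ext_deriv2 \<omega> c y u v w = 0) \<and>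
     (\<forall>c\<in>A. \<forall>y\<in>cimg c. \<forall>u. u \<noteq> 0 \<longrightarrow> (\<exists>v. \<omega> c y u v \<noteq> 0))"


section \<open>Symplectomorphisms\<close>

definition preserves_form ::
  "('m, 'e::euclidean_space) chart set \<Rightarrow> ('m, 'e) local_2form \<Rightarrow> ('m \<Rightarrow> 'm) \<Rightarrow> bool" where
  "preserves_form A \<omega> f \<longleftrightarrow>
     (\<forall>c\<in>A. \<forall>d\<in>A. \<forall>x\<in>cdom c. f x \<in> cdom d \<longrightarrow>
        (let D = frechet_derivative (cmap d \<circ> f \<circ> cinv c) (at (cmap c x))
         in \<forall>u v. \<omega> d (cmap d (f x)) (D u) (D v) = \<omega> c (cmap c x) u v))"

definition Symp ::
  "('m::topological_space, 'e::euclidean_space) chart set \<Rightarrow> ('m, 'e) local_2form \<Rightarrow> ('m \<Rightarrow> 'm) set"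
  where
  "Symp A \<omega> = {f. bij f \<and> smooth_map A f \<and> smooth_map A (inv f) \<and> preserves_form A \<omega> f}"

text \<open>The $C^\infty$ topology on smooth self-maps (Hirsch, Differential Topology, 2.1): a subbasic
  neighbourhood of \<open>f\<close> consists of the \<open>g\<close> whose local expressions are close to those of \<open>f\<close>, with
  all partial derivatives up to order \<open>r\<close>, on a compact subset of a chart domain.\<close>

definition Cinf_nbhd ::
  "('m::topological_space, 'e::euclidean_space) chart set \<Rightarrow> ('m \<Rightarrow> 'm) \<Rightarrow> nat \<Rightarrow> real \<Rightarrow>
   ('m, 'e) chart \<Rightarrow> ('m, 'e) chart \<Rightarrow> 'm set \<Rightarrow> ('m \<Rightarrow> 'm) set" where
  "Cinf_nbhd A f r \<epsilon> c d K =
     {g. smooth_map A g \<and> g ` K \<subseteq> cdom d \<and>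
         (\<forall>y\<in>cmap c ` K. \<forall>vs. set vs \<subseteq> Basis \<and> length vs \<le> r \<longrightarrow>
            norm (iter_dderiv vs (cmap d \<circ> g \<circ> cinv c) y
                - iter_dderiv vs (cmap d \<circ> f \<circ> cinv c) y) < \<epsilon>)}"

definition Cinf_topology ::
  "('m::topological_space, 'e::euclidean_space) chart set \<Rightarrow> ('m \<Rightarrow> 'm) topology" where
  "Cinf_topology A = topology_generated_by
     {Cinf_nbhd A f r \<epsilon> c d K | f r \<epsilon> c d K.
        smooth_map A f \<and> 0 < \<epsilon> \<and> c \<in> A \<and> d \<in> A \<and> compact K \<and> K \<subseteq> cdom c \<and> f ` K \<subseteq> cdom d}"

definition Symp0 ::
  "('m::topological_space, 'e::euclidean_space) chart set \<Rightarrow> ('m, 'e) local_2form \<Rightarrow> ('m \<Rightarrow> 'm) set"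
  where
  "Symp0 A \<omega> = connected_component_of_set (subtopology (Cinf_topology A) (Symp A \<omega>)) id"


section \<open>Hamiltonian symplectomorphisms\<close>

text \<open>The path \<open>h\<close> is an integral path of the Hamiltonian vector fields $X_t$ of \<open>F t\<close>, with
  $\omega(X_t,\cdot)=dF_t$. The opposite sign convention replaces \<open>F\<close> by \<open>-F\<close> and changes neither
  \<open>Ham\<close> nor the Hofer length.\<close>

definition generates ::
  "('m, 'e::euclidean_space) chart set \<Rightarrow> ('m, 'e) local_2form \<Rightarrow>
   (real \<Rightarrow> 'm \<Rightarrow> real) \<Rightarrow> (real \<Rightarrow> 'm \<Rightarrow> 'm) \<Rightarrow> bool" where
  "generates A \<omega> F h \<longleftrightarrow>
     (\<forall>t\<in>{0..1}. \<forall>x. \<forall>d\<in>A. h t x \<in> cdom d \<longrightarrow>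
        (\<exists>X. ((\<lambda>s. cmap d (h s x)) has_vector_derivative X) (at t within {0..1}) \<and>
             (\<forall>v. \<omega> d (cmap d (h t x)) X v =
                  frechet_derivative (F t \<circ> cinv d) (at (cmap d (h t x))) v)))"

text \<open>Time-1 maps of Hamiltonian flows. Such maps always lie in \<open>Symp0\<close>, by
  the invariance of \<open>\<omega>\<close> under Hamiltonian flows; here this is part of the definition.\<close>

definition Ham ::
  "('m::topological_space, 'e::euclidean_space) chart set \<Rightarrow> ('m, 'e) local_2form \<Rightarrow> ('m \<Rightarrow> 'm) set"
  where
  "Ham A \<omega> = {f \<in> Symp0 A \<omega>. \<exists>F h. smooth_fun_family A F \<and> smooth_map_family A h \<and>
                generates A \<omega> F h \<and> h 0 = id \<and> h 1 = f}"


section \<open>Integration against $\omega^n$\<close>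

text \<open>An enumeration of the standard basis; the choice affects \<open>top_power\<close> only by a sign.\<close>

definition basis_enum :: "nat \<Rightarrow> 'e::euclidean_space" where
  "basis_enum = (SOME b. bij_betw b {..<DIM('e)} Basis)"

text \<open>$\alpha^{\wedge n}$ evaluated on the standard basis, where \<open>DIM('e) = 2 * n\<close>. The wedge
  product of $n$ 2-forms is the signed sum over permutations divided by $(2!)^n$.\<close>

definition top_power :: "('e::euclidean_space \<Rightarrow> 'e \<Rightarrow> real) \<Rightarrow> real" where
  "top_power \<alpha> =
     (let n = DIM('e) div 2 in
      (\<Sum>\<sigma> | \<sigma> permutes {..<2 * n}.
         of_int (sign \<sigma>) * (\<Prod>i<n. \<alpha> (basis_enum (\<sigma> (2 * i))) (basis_enum (\<sigma> (2 * i + 1)))))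
      / 2 ^ n)"

definition partition_of_unity ::
  "('m::topological_space, 'e::euclidean_space) chart set \<Rightarrow> ('m, 'e) chart set \<Rightarrow>
   (('m, 'e) chart \<Rightarrow> 'm \<Rightarrow> real) \<Rightarrow> bool" where
  "partition_of_unity A C \<rho> \<longleftrightarrow> finite C \<and> C \<subseteq> A \<and>
     (\<forall>c\<in>C. smooth_fun A (\<rho> c) \<and> (\<forall>x. 0 \<le> \<rho> c x) \<and> closure {x. \<rho> c x \<noteq> 0} \<subseteq> cdom c) \<and>
     (\<forall>x. (\<Sum>c\<in>C. \<rho> c x) = 1)"

text \<open>$\int_M F\,\omega^n = I$, computed with a partition of unity (the value does not depend on the
  partition). \<open>M\<close> is oriented by $\omega^n$, so the density of $\omega^n$ in a chart is
  \<open>\<bar>top_power (\<omega> c y)\<bar>\<close> whether or not the chart is positively oriented.\<close>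

definition has_omega_integral ::
  "('m::topological_space, 'e::euclidean_space) chart set \<Rightarrow> ('m, 'e) local_2form \<Rightarrow>
   ('m \<Rightarrow> real) \<Rightarrow> real \<Rightarrow> bool" where
  "has_omega_integral A \<omega> F I \<longleftrightarrow>
     (\<exists>C \<rho>. partition_of_unity A C \<rho> \<and>
        I = (\<Sum>c\<in>C. set_lebesgue_integral lborel (cimg c)
               (\<lambda>y. \<rho> c (cinv c y) * F (cinv c y) * \<bar>top_power (\<omega> c y)\<bar>)))"


section \<open>The Hofer metric\<close>

definition Ham_path ::
  "('m::topological_space, 'e::euclidean_space) chart set \<Rightarrow> ('m, 'e) local_2form \<Rightarrow>
   (real \<Rightarrow> 'm \<Rightarrow> real) \<Rightarrow> (real \<Rightarrow> 'm \<Rightarrow> 'm) \<Rightarrow> bool" where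
  "Ham_path A \<omega> F h \<longleftrightarrow>
     smooth_map_family A h \<and> (\<forall>t\<in>{0..1}. h t \<in> Ham A \<omega>) \<and>
     smooth_fun_family A F \<and> (\<forall>t\<in>{0..1}. has_omega_integral A \<omega> (F t) 0) \<and>
     generates A \<omega> F h"

definition sup_norm :: "('m \<Rightarrow> real) \<Rightarrow> real" where
  "sup_norm F = (SUP x. \<bar>F x\<bar>)"

definition Hofer_length :: "(real \<Rightarrow> 'm \<Rightarrow> real) \<Rightarrow> real" where
  "Hofer_length F = integral {0..1} (\<lambda>t. sup_norm (F t))"

definition Hofer_dist ::
  "('m::topological_space, 'e::euclidean_space) chart set \<Rightarrow> ('m, 'e) local_2form \<Rightarrow>
   ('m \<Rightarrow> 'm) \<Rightarrow> ('m \<Rightarrow> 'm) \<Rightarrow> real" where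
  "Hofer_dist A \<omega> f g = Inf {Hofer_length F | F h. Ham_path A \<omega> F h \<and> h 0 = f \<and> h 1 = g}"

definition Hofer_norm ::
  "('m::topological_space, 'e::euclidean_space) chart set \<Rightarrow> ('m, 'e) local_2form \<Rightarrow>
   ('m \<Rightarrow> 'm) \<Rightarrow> real" where
  "Hofer_norm A \<omega> f = Hofer_dist A \<omega> id f"


section \<open>Bi-invariant extensions\<close>

text \<open>\<open>G\<close> is a set of bijections forming a group under composition.\<close>

definition bi_invariant_metric ::
  "('m \<Rightarrow> 'm) set \<Rightarrow> (('m \<Rightarrow> 'm) \<Rightarrow> ('m \<Rightarrow> 'm) \<Rightarrow> real) \<Rightarrow> bool" where
  "bi_invariant_metric G d \<longleftrightarrow> Metric_space G d \<and>
     (\<forall>\<phi>\<in>G. \<forall>\<psi>\<in>G. \<forall>\<theta>\<in>G. d (\<theta> \<circ> \<phi>) (\<theta> \<circ> \<psi>) = d \<phi> \<psi> \<and> d (\<phi> \<circ> \<theta>) (\<psi> \<circ> \<theta>) = d \<phi> \<psi>)"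

definition extends_bi_invariantly ::
  "('m \<Rightarrow> 'm) set \<Rightarrow> (('m \<Rightarrow> 'm) \<Rightarrow> ('m \<Rightarrow> 'm) \<Rightarrow> real) \<Rightarrow> ('m \<Rightarrow> 'm) set \<Rightarrow> bool" where
  "extends_bi_invariantly H d G \<longleftrightarrow>
     (\<exists>D. bi_invariant_metric G D \<and> (\<forall>f\<in>H. \<forall>g\<in>H. D f g = d f g))"

end

theory Submission
  imports Defs
begin

text \<open>If \<open>D\<close> is a bi-invariant extension and $g = \phi f \phi^{-1} f^{-1}$, then
  $D(id, g) = D(f, gf) = D(f\phi, \phi f) \le D(f\phi, f) + D(f, \phi f) = 2 D(id, \phi)$, a bound
  independent of \<open>f\<close>. The intermediate points must lie in \<open>Symp0\<close>, the identity component of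
  \<open>Symp\<close>, so the analytic content is that \<open>Symp0\<close> is closed under composition. This follows from
  continuity of right translation in the $C^\infty$ topology: by the iterated chain rule, the
  derivatives of $G \circ a$ up to order $r$ are linear in those of $G$, with coefficients that
  depend only on $a$ and are bounded on compact sets.\<close>

section \<open>Smooth functions\<close>

text \<open>Translation on the left would make the derivatives of g enter nonlinearly; on the right,
  one fixed operator turns differences into differences. The obstacle is that \<open>a\<close> need
  not carry a chart domain into a single chart. The estimate is therefore made near one point,
  through a chart around its image, and compactness of the test set combines finitely many such
  estimates. The strict bound at the point leaves a margin: part of it is spent on moving the point,
  the rest on replacing g0 by g. The commutator enters the metric argument only through g f \<phi> =
  \<phi> f, so every point handed to D is a product of elements known to lie in
  \<open>Symp0\<close>. Finally, \<open>Hofer_dist\<close> is a real infimum that has a value even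
  where no path exists, and the bound has to cover that value as well.\<close>

lemma differentiable_cong_open:
  assumes "open W" "x \<in> W" "\<And>y. y \<in> W \<Longrightarrow> f y = g y"
  shows "f differentiable (at x) \<longleftrightarrow> g differentiable (at x)"
  unfolding differentiable_def
  using has_derivative_transform_within_open[of f _ x UNIV W g]
    has_derivative_transform_within_open[of g _ x UNIV W f] assms
  by (metis)

text \<open>Both sides choose from the same set of candidate derivatives, so they agree even at a
  point where neither function is differentiable.\<close>

lemma frechet_derivative_cong_open:
  assumes "open W" "x \<in> W" "\<And>y. y \<in> W \<Longrightarrow> f y = g y"
  shows "frechet_derivative f (at x) = frechet_derivative g (at x)"
proof -
  have "(f has_derivative f') (at x) \<longleftrightarrow> (g has_derivative f') (at x)" for f'
    using has_derivative_transform_within_open[of f _ x UNIV W g]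
      has_derivative_transform_within_open[of g _ x UNIV W f] assms
    by metis
  then show ?thesis
    by (simp add: frechet_derivative_def)
qed

lemma iter_dderiv_append: "iter_dderiv (us @ vs) f = iter_dderiv us (iter_dderiv vs f)"
  by (induction us) auto

lemma iter_dderiv_cong_open:
  assumes "open W" "\<And>y. y \<in> W \<Longrightarrow> f y = g y" "x \<in> W"
  shows "iter_dderiv vs f x = iter_dderiv vs g x"
  using assms(3)
proof (induction vs arbitrary: x)
  case Nil
  then show ?case using assms(2) by simp
next
  case (Cons v vs)
  then show ?case
    using frechet_derivative_cong_open[OF assms(1) Cons.prems Cons.IH] by simp
qed

lemma smooth_openD:
  assumes "smooth_open W f"
  shows "open W" and "x \<in> W \<Longrightarrow> iter_dderiv vs f differentiable (at x)"
  using assms by (auto simp: smooth_open_def)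

lemma smooth_open_differentiable:
  assumes "smooth_open W f" "x \<in> W"
  shows "f differentiable (at x)"
  using smooth_openD(2)[OF assms, of "[]"] by simp

lemma smooth_open_iter_dderiv:
  assumes "smooth_open W f"
  shows "smooth_open W (iter_dderiv vs f)"
  using assms by (simp add: smooth_open_def flip: iter_dderiv_append)

lemma smooth_open_subset:
  assumes "smooth_open W f" "open V" "V \<subseteq> W"
  shows "smooth_open V f"
  using assms by (auto simp: smooth_open_def)

lemma smooth_open_continuous_at:
  assumes "smooth_open W f" "x \<in> W"
  shows "isCont (iter_dderiv vs f) x"
  using smooth_openD(2)[OF assms] by (rule differentiable_imp_continuous_within)

lemma smooth_open_continuous_on:
  assumes "smooth_open W f"
  shows "continuous_on W f"
  using smooth_open_continuous_at[OF assms, of _ "[]"]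
  by (simp add: continuous_at_imp_continuous_on)

text \<open>Around a point of an open \<open>S\<close> the local extension coincides with
  \<open>f\<close> on an open set, and so has the same iterated derivatives there.\<close>

lemma smooth_open_iff_smooth_on:
  assumes "open S"
  shows "smooth_open S f \<longleftrightarrow> smooth_on S f"
proof
  assume "smooth_open S f"
  then show "smooth_on S f"
    unfolding smooth_on_def by (intro ballI exI[of _ S] exI[of _ f]) simp
next
  assume f: "smooth_on S f"
  have "iter_dderiv vs f differentiable (at x)" if x: "x \<in> S" for x vs
  proof -
    obtain W g where W: "x \<in> W" "smooth_open W g" and fg: "\<forall>y\<in>S \<inter> W. f y = g y"
      using bspec[OF f[unfolded smooth_on_def] x] by (elim exE conjE) (rule that)
    have op: "open (S \<inter> W)"
      using assms smooth_openD(1)[OF W(2)] by blast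
    have "iter_dderiv vs f y = iter_dderiv vs g y" if "y \<in> S \<inter> W" for y
      by (rule iter_dderiv_cong_open[OF op _ that]) (use fg in simp)
    then show ?thesis
      using differentiable_cong_open[OF op, of x "iter_dderiv vs f" "iter_dderiv vs g"] x W(1)
        smooth_openD(2)[OF W(2,1)] by blast
  qed
  then show "smooth_open S f"
    using assms by (simp add: smooth_open_def)
qed

text \<open>Every iterated derivative of \<open>f\<close> agrees on \<open>W\<close> with a member
  of \<open>P\<close>, by induction on the list of directions, and members of \<open>P\<close> are
  differentiable. Closure properties thus follow from first derivatives alone, without a higher
  Leibniz formula.\<close>

lemma smooth_open_coinduct:
  assumes "open W" "P f"
    and "\<And>g x. P g \<Longrightarrow> x \<in> W \<Longrightarrow> g differentiable (at x)"
    and "\<And>g v. P g \<Longrightarrow> \<exists>g'. P g' \<and> (\<forall>x\<in>W. frechet_derivative g (at x) v = g' x)"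
  shows "smooth_open W f"
proof -
  have ex: "\<exists>g. P g \<and> (\<forall>x\<in>W. iter_dderiv vs f x = g x)" for vs
  proof (induction vs)
    case Nil
    then show ?case using assms(2) by auto
  next
    case (Cons v vs)
    then obtain g where g: "P g" "\<forall>x\<in>W. iter_dderiv vs f x = g x"
      by blast
    obtain g' where g': "P g'" "\<forall>x\<in>W. frechet_derivative g (at x) v = g' x"
      using assms(4)[OF g(1)] by blast
    have "frechet_derivative (iter_dderiv vs f) (at x) = frechet_derivative g (at x)"
      if "x \<in> W" for x
      using frechet_derivative_cong_open[OF assms(1) that] g(2) by blast
    then show ?case using g' by auto
  qed
  have "iter_dderiv vs f differentiable (at x)" if "x \<in> W" for vs x
    using ex[of vs] assms(3) differentiable_cong_open[OF assms(1) that] that by metis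
  then show ?thesis
    using assms(1) by (simp add: smooth_open_def)
qed

lemma frechet_derivative_eqI:
  assumes "(f has_derivative f') (at x)"
  shows "frechet_derivative f (at x) = f'"
  using frechet_derivative_at[OF assms] by simp

lemma smooth_open_has_derivative:
  assumes "smooth_open W f" "x \<in> W"
  shows "(iter_dderiv vs f has_derivative (\<lambda>v. iter_dderiv (v # vs) f x)) (at x)"
  using smooth_openD(2)[OF assms, of vs] by (simp add: frechet_derivative_works)

section \<open>Constants, components, products and differences of smooth functions\<close>

lemma smooth_open_const:
  assumes "open W"
  shows "smooth_open W (\<lambda>x. c)"
proof (rule smooth_open_coinduct[where P = "\<lambda>g. \<exists>c. g = (\<lambda>x. c)", OF assms])
  fix g :: "'a \<Rightarrow> 'b" and v
  assume "\<exists>c. g = (\<lambda>x. c)"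
  then show "\<exists>g'. (\<exists>c. g' = (\<lambda>x. c)) \<and> (\<forall>x\<in>W. frechet_derivative g (at x) v = g' x)"
    by auto
qed auto

lemma smooth_open_inner:
  assumes "smooth_open W f"
  shows "smooth_open W (\<lambda>x. f x \<bullet> b)"
proof (rule smooth_open_coinduct[where P = "\<lambda>g. \<exists>f. smooth_open W f \<and> g = (\<lambda>x. f x \<bullet> b)"])
  show "open W" using smooth_openD(1)[OF assms] .
  show "\<exists>f'. smooth_open W f' \<and> (\<lambda>x. f x \<bullet> b) = (\<lambda>x. f' x \<bullet> b)" using assms by blast
  fix g :: "'a \<Rightarrow> real"
  assume "\<exists>f. smooth_open W f \<and> g = (\<lambda>x. f x \<bullet> b)"
  then obtain f where f: "smooth_open W f" "g = (\<lambda>x. f x \<bullet> b)" by blast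
  have der: "(g has_derivative (\<lambda>v. iter_dderiv [v] f x \<bullet> b)) (at x)" if "x \<in> W" for x
    unfolding f(2)
    using smooth_open_has_derivative[OF f(1) that, of "[]"]
    by (auto intro: has_derivative_inner_left)
  show "g differentiable (at x)" if "x \<in> W" for x
    using der[OF that] differentiable_def by blast
  show "\<exists>g'. (\<exists>f. smooth_open W f \<and> g' = (\<lambda>x. f x \<bullet> b)) \<and>
      (\<forall>x\<in>W. frechet_derivative g (at x) v = g' x)" for v
    by (intro exI[of _ "\<lambda>x. iter_dderiv [v] f x \<bullet> b"] conjI ballI
        exI[of _ "iter_dderiv [v] f"] smooth_open_iter_dderiv f(1) refl)
      (simp add: frechet_derivative_eqI[OF der])
qed

text \<open>The invariant for \<open>smooth_open_mult\<close>: the derivative of a product is a sum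
  of two products, so single products do not form a class closed under differentiation.\<close>

inductive sum_of_products :: "'a::euclidean_space set \<Rightarrow> ('a \<Rightarrow> real) \<Rightarrow> bool" for W where
  prod: "smooth_open W f \<Longrightarrow> smooth_open W g \<Longrightarrow> sum_of_products W (\<lambda>x. f x * g x)"
| add: "sum_of_products W f \<Longrightarrow> sum_of_products W g \<Longrightarrow> sum_of_products W (\<lambda>x. f x + g x)"

lemma smooth_open_mult:
  fixes f g :: "'a::euclidean_space \<Rightarrow> real"
  assumes "smooth_open W f" "smooth_open W g"
  shows "smooth_open W (\<lambda>x. f x * g x)"
proof -
  \<comment> \<open>The derivative is kept as one function of the direction \<open>v\<close>: the
    induction adds whole derivatives, and each fixed direction returns to the class.\<close>
  have step: "\<exists>h'. (\<forall>v. sum_of_products W (\<lambda>x. h' x v)) \<and>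
      (\<forall>x\<in>W. (h has_derivative h' x) (at x))"
    if "sum_of_products W h" for h
    using that
  proof induction
    case (prod f g)
    let ?h' = "\<lambda>x v. f x * iter_dderiv [v] g x + iter_dderiv [v] f x * g x"
    have "sum_of_products W (\<lambda>x. ?h' x v)" for v
      by (intro sum_of_products.intros prod smooth_open_iter_dderiv)
    moreover have "((\<lambda>x. f x * g x) has_derivative ?h' x) (at x)" if "x \<in> W" for x
      using smooth_open_has_derivative[OF prod(1) that, of "[]"]
        smooth_open_has_derivative[OF prod(2) that, of "[]"]
      by (auto intro!: has_derivative_mult)
    ultimately show ?case by (intro exI[of _ ?h']) blast
  next
    case (add f g)
    from add.IH(1) obtain f' where
      "\<forall>v. sum_of_products W (\<lambda>x. f' x v)" "\<forall>x\<in>W. (f has_derivative f' x) (at x)"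
      by (elim exE conjE) (rule that)
    moreover from add.IH(2) obtain g' where
      "\<forall>v. sum_of_products W (\<lambda>x. g' x v)" "\<forall>x\<in>W. (g has_derivative g' x) (at x)"
      by (elim exE conjE) (rule that)
    ultimately show ?case
      by (intro exI[of _ "\<lambda>x v. f' x v + g' x v"])
        (auto intro: sum_of_products.add has_derivative_add)
  qed
  show ?thesis
  proof (rule smooth_open_coinduct[where P = "sum_of_products W"])
    show "open W" using smooth_openD(1)[OF assms(1)] .
    show "sum_of_products W (\<lambda>x. f x * g x)" using assms by (rule sum_of_products.prod)
    show "h differentiable (at x)" if "sum_of_products W h" "x \<in> W" for h x
      using step[OF that(1)] that(2) differentiable_def by blast
    show "\<exists>h'. sum_of_products W h' \<and> (\<forall>x\<in>W. frechet_derivative h (at x) v = h' x)"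
      if "sum_of_products W h" for h v
      using step[OF that] frechet_derivative_eqI by metis
  qed
qed

lemma iter_dderiv_diff:
  assumes "smooth_open W f" "smooth_open W g" "x \<in> W"
  shows "iter_dderiv vs (\<lambda>y. f y - g y) x = iter_dderiv vs f x - iter_dderiv vs g x"
  using assms(3)
proof (induction vs arbitrary: x)
  case (Cons v vs)
  have "frechet_derivative (iter_dderiv vs (\<lambda>y. f y - g y)) (at x)
      = frechet_derivative (\<lambda>y. iter_dderiv vs f y - iter_dderiv vs g y) (at x)"
    by (rule frechet_derivative_cong_open[OF smooth_openD(1)[OF assms(1)] Cons.prems Cons.IH])
  also have "\<dots> = (\<lambda>v. iter_dderiv (v # vs) f x - iter_dderiv (v # vs) g x)"
    by (intro frechet_derivative_eqI has_derivative_diff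
        smooth_open_has_derivative[OF assms(1) Cons.prems]
        smooth_open_has_derivative[OF assms(2) Cons.prems])
  finally show ?case by simp
qed simp

lemma smooth_open_diff:
  assumes "smooth_open W f" "smooth_open W g"
  shows "smooth_open W (\<lambda>x. f x - g x)"
  unfolding smooth_open_def
proof (intro conjI allI ballI)
  show op: "open W" using smooth_openD(1)[OF assms(1)] .
  fix vs x assume x: "x \<in> W"
  show "iter_dderiv vs (\<lambda>x. f x - g x) differentiable (at x)"
    by (rule differentiable_cong_open[THEN iffD2, OF op x iter_dderiv_diff[OF assms]
          differentiable_diff[OF smooth_openD(2)[OF assms(1) x] smooth_openD(2)[OF assms(2) x]]])
qed

section \<open>The iterated chain rule\<close>

text \<open>The form of the operators $H \mapsto \partial^\alpha (H \circ \phi)$; what matters is that the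
  coefficients do not depend on \<open>H\<close>.\<close>

inductive chain_op ::
  "'a::euclidean_space set \<Rightarrow> ('a \<Rightarrow> 'b::euclidean_space) \<Rightarrow> nat \<Rightarrow>
   (('b \<Rightarrow> 'c::euclidean_space) \<Rightarrow> 'a \<Rightarrow> 'c) \<Rightarrow> bool" for V \<phi> n where
  base: "smooth_open V a \<Longrightarrow> set ws \<subseteq> Basis \<Longrightarrow> length ws \<le> n \<Longrightarrow>
    chain_op V \<phi> n (\<lambda>H x. a x *\<^sub>R iter_dderiv ws H (\<phi> x))"
| add: "chain_op V \<phi> n S \<Longrightarrow> chain_op V \<phi> n T \<Longrightarrow> chain_op V \<phi> n (\<lambda>H x. S H x + T H x)"

lemma chain_op_sum:
  assumes "open V" "finite I" "\<And>i. i \<in> I \<Longrightarrow> chain_op V \<phi> n (T i)"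
  shows "chain_op V \<phi> n (\<lambda>H x. \<Sum>i\<in>I. T i H x)"
  using assms(2,3)
proof (induction I)
  case empty
  have "chain_op V \<phi> n (\<lambda>H x. 0 *\<^sub>R iter_dderiv [] H (\<phi> x))"
    by (rule chain_op.base) (auto intro: smooth_open_const assms(1))
  then show ?case by simp
next
  case (insert i I)
  then show ?case by (auto intro!: chain_op.add)
qed

text \<open>Differentiating one term \<open>a x *\<^sub>R iter_dderiv ws H (\<phi> x)\<close> either
  hits the coefficient or, by the chain rule, prolongs \<open>ws\<close> by one direction; hence
  \<open>Suc n\<close>. The operators \<open>T'\<close> are found before \<open>H\<close>,
  \<open>W\<close> and \<open>x\<close>, so their coefficients remain independent of
  \<open>H\<close>.\<close>

lemma chain_op_deriv:
  assumes \<phi>: "smooth_open V \<phi>" and T: "chain_op V \<phi> n T"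
  shows "\<exists>T'. (\<forall>v. chain_op V \<phi> (Suc n) (T' v)) \<and>
    (\<forall>H W x. smooth_open W H \<longrightarrow> x \<in> V \<longrightarrow> \<phi> x \<in> W \<longrightarrow>
       (T H has_derivative (\<lambda>v. T' v H x)) (at x))"
  using T
proof induction
  case (base a ws)
  \<comment> \<open>The derivative of \<open>\<phi>\<close> in direction \<open>v\<close> is
    expanded in the standard basis: its components join the coefficient, and only basis vectors are
    put in front of \<open>ws\<close>.\<close>
  let ?T' = "\<lambda>v H x. iter_dderiv [v] a x *\<^sub>R iter_dderiv ws H (\<phi> x) +
    (\<Sum>b\<in>Basis. (a x * (iter_dderiv [v] \<phi> x \<bullet> b)) *\<^sub>R iter_dderiv (b # ws) H (\<phi> x))"
  have "chain_op V \<phi> (Suc n) (?T' v)" for v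
  proof (intro chain_op.add chain_op_sum)
    show "chain_op V \<phi> (Suc n) (\<lambda>H x. iter_dderiv [v] a x *\<^sub>R iter_dderiv ws H (\<phi> x))"
      by (rule chain_op.base) (use base in \<open>auto intro!: smooth_open_iter_dderiv simp del: iter_dderiv.simps\<close>)
    show "chain_op V \<phi> (Suc n)
        (\<lambda>H x. (a x * (iter_dderiv [v] \<phi> x \<bullet> b)) *\<^sub>R iter_dderiv (b # ws) H (\<phi> x))"
      if "b \<in> Basis" for b
    proof (rule chain_op.base)
      show "smooth_open V (\<lambda>x. a x * (iter_dderiv [v] \<phi> x \<bullet> b))"
        by (intro smooth_open_mult smooth_open_inner smooth_open_iter_dderiv base \<phi>)
    qed (use base that in auto)
  qed (use smooth_openD(1)[OF \<phi>] in auto)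
  moreover have "((\<lambda>x. a x *\<^sub>R iter_dderiv ws H (\<phi> x)) has_derivative (\<lambda>v. ?T' v H x)) (at x)"
    if H: "smooth_open W H" and x: "x \<in> V" "\<phi> x \<in> W" for H W x
  proof -
    let ?L = "\<lambda>w. iter_dderiv (w # ws) H (\<phi> x)"
    have L: "(iter_dderiv ws H has_derivative ?L) (at (\<phi> x))"
      by (rule smooth_open_has_derivative[OF H x(2)])
    then have lin: "linear ?L"
      using has_derivative_linear by blast
    have d\<phi>: "(\<phi> has_derivative (\<lambda>v. iter_dderiv [v] \<phi> x)) (at x)"
      using smooth_open_has_derivative[OF \<phi> x(1), of "[]"] by simp
    have da: "(a has_derivative (\<lambda>v. iter_dderiv [v] a x)) (at x)"
      using smooth_open_has_derivative[OF base(1) x(1), of "[]"] by simp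
    have "((\<lambda>x. iter_dderiv ws H (\<phi> x)) has_derivative (\<lambda>v. ?L (iter_dderiv [v] \<phi> x))) (at x)"
      using has_derivative_compose[OF d\<phi> L] .
    from has_derivative_scaleR[OF da this]
    have *: "((\<lambda>x. a x *\<^sub>R iter_dderiv ws H (\<phi> x)) has_derivative
        (\<lambda>v. a x *\<^sub>R ?L (iter_dderiv [v] \<phi> x) + iter_dderiv [v] a x *\<^sub>R iter_dderiv ws H (\<phi> x))) (at x)" .
    have exp: "?L w = (\<Sum>b\<in>Basis. (w \<bullet> b) *\<^sub>R ?L b)" for w
    proof -
      have "?L w = ?L (\<Sum>b\<in>Basis. (w \<bullet> b) *\<^sub>R b)"
        by (simp add: euclidean_representation)
      also have "\<dots> = (\<Sum>b\<in>Basis. ?L ((w \<bullet> b) *\<^sub>R b))"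
        by (rule linear_sum[OF lin])
      also have "\<dots> = (\<Sum>b\<in>Basis. (w \<bullet> b) *\<^sub>R ?L b)"
        by (intro sum.cong refl linear_cmul[OF lin])
      finally show ?thesis .
    qed
    have "(\<lambda>v. a x *\<^sub>R ?L (iter_dderiv [v] \<phi> x) + iter_dderiv [v] a x *\<^sub>R iter_dderiv ws H (\<phi> x))
        = (\<lambda>v. ?T' v H x)"
      by (subst exp) (simp add: scaleR_sum_right add.commute)
    with * show ?thesis by (simp only:)
  qed
  ultimately show ?case
    by (intro exI[of _ ?T']) blast
next
  case (add S T)
  from add.IH(1) obtain S' where S': "\<forall>v. chain_op V \<phi> (Suc n) (S' v)"
    "\<forall>H W x. smooth_open W H \<longrightarrow> x \<in> V \<longrightarrow> \<phi> x \<in> W \<longrightarrow> (S H has_derivative (\<lambda>v. S' v H x)) (at x)"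
    by (elim exE conjE) (rule that)
  from add.IH(2) obtain T' where T': "\<forall>v. chain_op V \<phi> (Suc n) (T' v)"
    "\<forall>H W x. smooth_open W H \<longrightarrow> x \<in> V \<longrightarrow> \<phi> x \<in> W \<longrightarrow> (T H has_derivative (\<lambda>v. T' v H x)) (at x)"
    by (elim exE conjE) (rule that)
  show ?case
    by (intro exI[of _ "\<lambda>v H x. S' v H x + T' v H x"] conjI allI impI chain_op.add
        has_derivative_add S'(1)[rule_format] T'(1)[rule_format])
      (use S'(2) T'(2) in blast)+
qed

lemma open_Int_vimage_smooth:
  assumes "smooth_open V \<phi>" "open W"
  shows "open (V \<inter> \<phi> -` W)"
  using continuous_on_open_vimage smooth_open_continuous_on smooth_openD(1) assms
  by (metis Int_commute)

text \<open>Faa di Bruno's formula in qualitative form, by repeated use of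
  \<open>chain_op_deriv\<close>: it records only how many derivatives fall on \<open>H\<close> and
  that \<open>T\<close> is independent of \<open>H\<close>.\<close>

lemma iter_dderiv_comp:
  fixes \<phi> :: "'a::euclidean_space \<Rightarrow> 'b::euclidean_space" and vs :: "'a list"
  assumes \<phi>: "smooth_open V \<phi>"
  shows "\<exists>T :: ('b \<Rightarrow> 'c::euclidean_space) \<Rightarrow> 'a \<Rightarrow> 'c. chain_op V \<phi> (length vs) T \<and>
    (\<forall>H W x. smooth_open W H \<longrightarrow> x \<in> V \<longrightarrow> \<phi> x \<in> W \<longrightarrow> iter_dderiv vs (H \<circ> \<phi>) x = T H x)"
proof (induction vs)
  case Nil
  have "chain_op V \<phi> 0 (\<lambda>H x. 1 *\<^sub>R iter_dderiv [] H (\<phi> x))"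
    by (rule chain_op.base) (auto intro: smooth_open_const smooth_openD(1)[OF \<phi>])
  then show ?case by auto
next
  case (Cons v vs)
  then obtain T :: "('b \<Rightarrow> 'c) \<Rightarrow> 'a \<Rightarrow> 'c" where T: "chain_op V \<phi> (length vs) T"
    "\<forall>H W x. smooth_open W H \<longrightarrow> x \<in> V \<longrightarrow> \<phi> x \<in> W \<longrightarrow> iter_dderiv vs (H \<circ> \<phi>) x = T H x"
    by blast
  obtain T' where T': "\<forall>v. chain_op V \<phi> (Suc (length vs)) (T' v)"
    "\<forall>H W x. smooth_open W H \<longrightarrow> x \<in> V \<longrightarrow> \<phi> x \<in> W \<longrightarrow>
       (T H has_derivative (\<lambda>v. T' v H x)) (at x)"
    using chain_op_deriv[OF \<phi> T(1)] by (elim exE conjE) (rule that)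
  have "iter_dderiv (v # vs) (H \<circ> \<phi>) x = T' v H x"
    if H: "smooth_open W H" and x: "x \<in> V" "\<phi> x \<in> W" for H W x
  proof -
    \<comment> \<open>The formula for \<open>vs\<close> holds at all points of \<open>V\<close> that
      \<open>\<phi>\<close> maps into \<open>W\<close>. These form an open set, so the formula may
      be differentiated.\<close>
    have "frechet_derivative (iter_dderiv vs (H \<circ> \<phi>)) (at x) = frechet_derivative (T H) (at x)"
      by (rule frechet_derivative_cong_open[OF
            open_Int_vimage_smooth[OF \<phi> smooth_openD(1)[OF H]]]) (use T(2) H x in auto)
    also have "\<dots> = (\<lambda>v. T' v H x)"
      by (rule frechet_derivative_eqI) (use T'(2) H x in blast)
    finally show ?thesis by simp
  qed
  then show ?case
    using T'(1) by (intro exI[of _ "T' v"]) (simp del: iter_dderiv.simps o_apply)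
qed

text \<open>Each iterated derivative of the composite agrees on an open set with some
  \<open>T H\<close>, and \<open>chain_op_deriv\<close> supplies the derivative of
  \<open>T H\<close>.\<close>

lemma smooth_open_comp:
  fixes \<phi> :: "'a::euclidean_space \<Rightarrow> 'b::euclidean_space"
    and H :: "'b \<Rightarrow> 'c::euclidean_space"
  assumes \<phi>: "smooth_open V \<phi>" and H: "smooth_open W H"
  shows "smooth_open (V \<inter> \<phi> -` W) (H \<circ> \<phi>)"
  unfolding smooth_open_def
proof (intro conjI allI ballI)
  show op: "open (V \<inter> \<phi> -` W)"
    by (rule open_Int_vimage_smooth[OF \<phi> smooth_openD(1)[OF H]])
  fix vs x assume x: "x \<in> V \<inter> \<phi> -` W"
  obtain T :: "('b \<Rightarrow> 'c) \<Rightarrow> 'a \<Rightarrow> 'c" where T: "chain_op V \<phi> (length vs) T"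
    "\<forall>H W x. smooth_open W H \<longrightarrow> x \<in> V \<longrightarrow> \<phi> x \<in> W \<longrightarrow> iter_dderiv vs (H \<circ> \<phi>) x = T H x"
    using iter_dderiv_comp[OF \<phi>, of vs] by blast
  obtain T' where
    "\<forall>H W x. smooth_open W H \<longrightarrow> x \<in> V \<longrightarrow> \<phi> x \<in> W \<longrightarrow>
       (T H has_derivative (\<lambda>v. T' v H x)) (at x)"
    using chain_op_deriv[OF \<phi> T(1)] by (elim exE conjE) (rule that)
  then have "(T H has_derivative (\<lambda>v. T' v H x)) (at x)"
    using H x by blast
  then have "T H differentiable (at x)"
    unfolding differentiable_def by blast
  moreover have "iter_dderiv vs (H \<circ> \<phi>) y = T H y" if "y \<in> V \<inter> \<phi> -` W" for y
    using T(2) H that by blast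
  ultimately show "iter_dderiv vs (H \<circ> \<phi>) differentiable (at x)"
    using differentiable_cong_open[OF op x] by blast
qed

text \<open>The coefficients are continuous, hence bounded on the compact set \<open>K\<close>. The
  constant \<open>C\<close> depends on the operator and on \<open>K\<close> alone, while
  \<open>M\<close> bounds the derivatives of \<open>H\<close> at the single point
  \<open>\<phi> x\<close>.\<close>

lemma chain_op_bound:
  fixes \<phi> :: "'a::euclidean_space \<Rightarrow> 'b::euclidean_space"
    and T :: "('b \<Rightarrow> 'c::euclidean_space) \<Rightarrow> 'a \<Rightarrow> 'c"
  assumes "chain_op V \<phi> n T" "compact K" "K \<subseteq> V"
  shows "\<exists>C\<ge>0. \<forall>H x M. x \<in> K \<longrightarrow>
    (\<forall>ws. set ws \<subseteq> Basis \<and> length ws \<le> n \<longrightarrow> norm (iter_dderiv ws H (\<phi> x)) \<le> M) \<longrightarrow>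
    norm (T H x) \<le> C * M"
  using assms(1)
proof induction
  case (base a ws)
  have "compact (a ` K)"
    using continuous_on_subset[OF smooth_open_continuous_on[OF base(1)] assms(3)] assms(2)
    by (rule compact_continuous_image)
  then have "bounded (a ` K)"
    by (rule compact_imp_bounded)
  then obtain C where C: "\<And>x. x \<in> K \<Longrightarrow> norm (a x) \<le> C"
    unfolding bounded_iff by auto
  \<comment> \<open>For empty \<open>K\<close> the bound \<open>C\<close> may be negative, hence the
    maximum with 0.\<close>
  have "norm (a x *\<^sub>R iter_dderiv ws H (\<phi> x)) \<le> max 0 C * M"
    if "x \<in> K" "\<forall>ws. set ws \<subseteq> Basis \<and> length ws \<le> n \<longrightarrow> norm (iter_dderiv ws H (\<phi> x)) \<le> M"
    for H :: "'b \<Rightarrow> 'c" and x M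
    unfolding norm_scaleR
  proof (rule mult_mono)
    show "\<bar>a x\<bar> \<le> max 0 C" using C[OF that(1)] by simp
  qed (use base that(2) in auto)
  then show ?case by (intro exI[of _ "max 0 C"]) auto
next
  case (add S T)
  let ?le = "\<lambda>H x M. \<forall>ws. set ws \<subseteq> Basis \<and> length ws \<le> n \<longrightarrow> norm (iter_dderiv ws H (\<phi> x)) \<le> M"
  from add.IH(1) obtain C where C: "C \<ge> 0"
    "\<And>H x M. x \<in> K \<Longrightarrow> ?le H x M \<Longrightarrow> norm (S H x) \<le> C * M"
    by (elim exE conjE) simp
  from add.IH(2) obtain D where D: "D \<ge> 0"
    "\<And>H x M. x \<in> K \<Longrightarrow> ?le H x M \<Longrightarrow> norm (T H x) \<le> D * M"
    by (elim exE conjE) simp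
  have "norm (S H x + T H x) \<le> (C + D) * M" if "x \<in> K" "?le H x M" for H x M
    using C(2)[OF that] D(2)[OF that] norm_triangle_ineq[of "S H x" "T H x"]
    by (simp add: distrib_right)
  then show ?case using C(1) D(1) by (intro exI[of _ "C + D"]) simp
qed

text \<open>Intended for \<open>H\<close> equal to the difference of two local expressions: it
  converts closeness of two maps into closeness of their right translates, with \<open>C\<close>
  independent of the maps.\<close>

lemma iter_dderiv_comp_bound:
  fixes \<phi> :: "'a::euclidean_space \<Rightarrow> 'b::euclidean_space" and vs :: "'a list"
  assumes \<phi>: "smooth_open V \<phi>" and K: "compact K" "K \<subseteq> V"
  shows "\<exists>C\<ge>0. \<forall>(H :: 'b \<Rightarrow> 'c::euclidean_space) W x M.
    smooth_open W H \<longrightarrow> x \<in> K \<longrightarrow> \<phi> x \<in> W \<longrightarrow>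
    (\<forall>ws. set ws \<subseteq> Basis \<and> length ws \<le> length vs \<longrightarrow> norm (iter_dderiv ws H (\<phi> x)) \<le> M) \<longrightarrow>
    norm (iter_dderiv vs (H \<circ> \<phi>) x) \<le> C * M"
proof -
  obtain T :: "('b \<Rightarrow> 'c) \<Rightarrow> 'a \<Rightarrow> 'c" where T: "chain_op V \<phi> (length vs) T"
    "\<forall>H W x. smooth_open W H \<longrightarrow> x \<in> V \<longrightarrow> \<phi> x \<in> W \<longrightarrow> iter_dderiv vs (H \<circ> \<phi>) x = T H x"
    using iter_dderiv_comp[OF \<phi>, of vs] by blast
  obtain C where C: "C \<ge> 0" "\<forall>H x M. x \<in> K \<longrightarrow>
      (\<forall>ws. set ws \<subseteq> Basis \<and> length ws \<le> length vs \<longrightarrow> norm (iter_dderiv ws H (\<phi> x)) \<le> M) \<longrightarrow>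
      norm (T H x) \<le> C * M"
    using chain_op_bound[OF T(1) K] by (elim exE conjE) (rule that)
  show ?thesis
  proof (intro exI[of _ C] conjI C(1) allI impI)
    fix H :: "'b \<Rightarrow> 'c" and W x M
    assume H: "smooth_open W H" "x \<in> K" "\<phi> x \<in> W"
      and M: "\<forall>ws. set ws \<subseteq> Basis \<and> length ws \<le> length vs \<longrightarrow> norm (iter_dderiv ws H (\<phi> x)) \<le> M"
    have "iter_dderiv vs (H \<circ> \<phi>) x = T H x"
      using T(2) H K(2) by blast
    then show "norm (iter_dderiv vs (H \<circ> \<phi>) x) \<le> C * M"
      using C(2) H(2) M by simp
  qed
qed

section \<open>Local expressions of maps\<close>

text \<open>With \<open>local_map\<close>, this names the set and the function that occur literally
  in \<open>smooth_map\<close>, so that its definition can be folded into these terms.\<close>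

definition local_dom ::
  "('m, 'e) chart \<Rightarrow> ('m \<Rightarrow> 'm) \<Rightarrow> ('m, 'e) chart \<Rightarrow> 'e set" where
  "local_dom c f d = cmap c ` (cdom c \<inter> f -` cdom d)"

definition local_map ::
  "('m, 'e) chart \<Rightarrow> ('m \<Rightarrow> 'm) \<Rightarrow> ('m, 'e) chart \<Rightarrow> 'e \<Rightarrow> 'e" where
  "local_map c f d = cmap d \<circ> f \<circ> cinv c"

lemma is_chartD:
  assumes "is_chart c"
  shows "open (cdom c)" "open (cimg c)" "continuous_on (cimg c) (cinv c)"
    "x \<in> cdom c \<Longrightarrow> cinv c (cmap c x) = x" "y \<in> cimg c \<Longrightarrow> cinv c y \<in> cdom c"
    "y \<in> cimg c \<Longrightarrow> cmap c (cinv c y) = y" "x \<in> cdom c \<Longrightarrow> cmap c x \<in> cimg c"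
    "continuous_on (cdom c) (cmap c)"
  using assms unfolding is_chart_def homeomorphism_def by auto

lemma mem_local_dom_iff:
  assumes "is_chart c"
  shows "y \<in> local_dom c f d \<longleftrightarrow> y \<in> cimg c \<and> f (cinv c y) \<in> cdom d"
proof
  assume "y \<in> local_dom c f d"
  then show "y \<in> cimg c \<and> f (cinv c y) \<in> cdom d"
    by (auto simp: local_dom_def is_chartD(4,7)[OF assms])
next
  assume "y \<in> cimg c \<and> f (cinv c y) \<in> cdom d"
  then have "cinv c y \<in> cdom c \<inter> f -` cdom d" "y = cmap c (cinv c y)"
    using is_chartD(5,6)[OF assms] by auto
  then show "y \<in> local_dom c f d"
    unfolding local_dom_def by (intro image_eqI[where x = "cinv c y"])
qed

lemma open_local_dom:
  assumes "is_chart c" "is_chart d" "continuous_on UNIV f"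
  shows "open (local_dom c f d)"
proof -
  have "continuous_on (cimg c) (\<lambda>y. f (cinv c y))"
    using continuous_on_compose2[OF assms(3) is_chartD(3)[OF assms(1)]] by simp
  then have "open ((\<lambda>y. f (cinv c y)) -` cdom d \<inter> cimg c)"
    using continuous_on_open_vimage[OF is_chartD(2)[OF assms(1)]] is_chartD(1)[OF assms(2)] by blast
  moreover have "local_dom c f d = (\<lambda>y. f (cinv c y)) -` cdom d \<inter> cimg c"
    by (auto simp: mem_local_dom_iff[OF assms(1)])
  ultimately show ?thesis by simp
qed

text \<open>At a point of \<open>local_dom c f c'\<close> the inserted chart cancels, since
  \<open>cinv c'\<close> undoes \<open>cmap c'\<close> on \<open>cdom c'\<close>.\<close>

lemma local_map_comp:
  assumes "is_chart c" "is_chart c'" "y \<in> local_dom c f c'"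
  shows "local_map c' g d (local_map c f c' y) = local_map c (g \<circ> f) d y"
    and "local_map c f c' y \<in> local_dom c' g d \<longleftrightarrow> y \<in> local_dom c (g \<circ> f) d"
  using assms is_chartD[OF assms(2)] by (auto simp: local_map_def mem_local_dom_iff)

text \<open>Finitely many strict inequalities leave a common margin below \<open>\<epsilon>\<close>;
  it provides the room for changing the map in the estimate for translations.\<close>

lemma finite_less_dense:
  fixes m :: "'i \<Rightarrow> real"
  assumes "finite I" "\<And>i. i \<in> I \<Longrightarrow> m i < \<epsilon>"
  obtains e where "e < \<epsilon>" "\<And>i. i \<in> I \<Longrightarrow> m i < e"
proof -
  have "\<exists>e<\<epsilon>. \<forall>i\<in>I. m i < e"
    using assms
  proof (induction I)
    case empty
    show ?case by (rule exI[of _ "\<epsilon> - 1"]) simp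
  next
    case (insert j I)
    then obtain e where e: "e < \<epsilon>" "\<forall>i\<in>I. m i < e" by auto
    have "m j < \<epsilon>" using insert.prems by simp
    then have "max e ((m j + \<epsilon>) / 2) < \<epsilon>" "\<forall>i\<in>insert j I. m i < max e ((m j + \<epsilon>) / 2)"
      using e by (auto simp: less_max_iff_disj)
    then show ?case by blast
  qed
  then show thesis using that by blast
qed

section \<open>Composition of smooth maps and of symplectomorphisms\<close>

locale charted =
  fixes A :: "('m::{t2_space, second_countable_topology}, 'e::euclidean_space) chart set"
  assumes is_chart: "c \<in> A \<Longrightarrow> is_chart c"
    and cover: "(\<Union>c\<in>A. cdom c) = UNIV"
begin

lemma obtain_chart:
  obtains c where "c \<in> A" "x \<in> cdom c"
  using cover by blast

text \<open>Continuity of \<open>f\<close> makes the domains of its local expressions open, which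
  lets \<open>smooth_on\<close> be traded for \<open>smooth_open\<close> and hence for iterated
  derivatives.\<close>

lemma smooth_map_iff:
  "smooth_map A f \<longleftrightarrow> continuous_on UNIV f \<and>
    (\<forall>c\<in>A. \<forall>d\<in>A. smooth_open (local_dom c f d) (local_map c f d))"
  unfolding smooth_map_def local_map_def[symmetric] local_dom_def[symmetric]
  using smooth_open_iff_smooth_on[OF open_local_dom] is_chart by (metis (no_types, lifting))

lemma smooth_mapD:
  assumes "smooth_map A f"
  shows "continuous_on UNIV f"
    and "c \<in> A \<Longrightarrow> d \<in> A \<Longrightarrow> smooth_open (local_dom c f d) (local_map c f d)"
  using assms by (auto simp: smooth_map_iff)

text \<open>The image under \<open>f\<close> of a chart domain may meet many charts, so smoothness
  is shown near each point, through a chart \<open>c'\<close> around its image;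
  \<open>smooth_on\<close> is the notion that admits such a local proof.\<close>

lemma smooth_map_comp:
  assumes f: "smooth_map A f" and g: "smooth_map A g"
  shows "smooth_map A (g \<circ> f)"
  unfolding smooth_map_iff
proof (intro conjI ballI)
  show cont: "continuous_on UNIV (g \<circ> f)"
    using continuous_on_compose[OF smooth_mapD(1)[OF f]] smooth_mapD(1)[OF g]
      continuous_on_subset by blast
  fix c d assume c: "c \<in> A" and d: "d \<in> A"
  have "smooth_on (local_dom c (g \<circ> f) d) (local_map c (g \<circ> f) d)"
    unfolding smooth_on_def
  proof
    fix y assume y: "y \<in> local_dom c (g \<circ> f) d"
    obtain c' where c': "c' \<in> A" "f (cinv c y) \<in> cdom c'"
      by (rule obtain_chart)
    let ?\<phi> = "local_map c f c'" and ?V = "local_dom c f c'"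
    let ?W = "?V \<inter> ?\<phi> -` local_dom c' g d"
    have yV: "y \<in> ?V"
      using y c' mem_local_dom_iff[OF is_chart[OF c]] by blast
    have "smooth_open ?W (local_map c' g d \<circ> ?\<phi>)"
      using smooth_open_comp[OF smooth_mapD(2)[OF f c c'(1)] smooth_mapD(2)[OF g c'(1) d]] .
    moreover have "y \<in> ?W"
      using yV y local_map_comp(2)[OF is_chart[OF c] is_chart[OF c'(1)] yV] by blast
    moreover have "local_map c (g \<circ> f) d z = (local_map c' g d \<circ> ?\<phi>) z" if "z \<in> ?W" for z
      using local_map_comp(1)[OF is_chart[OF c] is_chart[OF c'(1)]] that by simp
    ultimately show "\<exists>W h. y \<in> W \<and> smooth_open W h \<and>
        (\<forall>z\<in>local_dom c (g \<circ> f) d \<inter> W. local_map c (g \<circ> f) d z = h z)"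
      by (intro exI[of _ ?W] exI[of _ "local_map c' g d \<circ> ?\<phi>"]) simp
  qed
  then show "smooth_open (local_dom c (g \<circ> f) d) (local_map c (g \<circ> f) d)"
    using smooth_open_iff_smooth_on[OF open_local_dom[OF is_chart[OF c] is_chart[OF d] cont]]
    by blast
qed

text \<open>Chain rule through a chart \<open>c'\<close> around \<open>f x\<close>: the derivative
  of the composite is \<open>?E \<circ> ?D\<close>, where \<open>?E\<close> is absorbed by the
  invariance under \<open>g\<close> and \<open>?D\<close> by that under \<open>f\<close>.\<close>

lemma preserves_form_comp:
  assumes f: "smooth_map A f" "preserves_form A \<omega> f"
    and g: "smooth_map A g" "preserves_form A \<omega> g"
  shows "preserves_form A \<omega> (g \<circ> f)"
  unfolding preserves_form_def Let_def local_map_def[symmetric]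
proof (intro ballI impI allI)
  fix c d x u v
  assume c: "c \<in> A" and d: "d \<in> A" and x: "x \<in> cdom c" "(g \<circ> f) x \<in> cdom d"
  obtain c' where c': "c' \<in> A" "f x \<in> cdom c'"
    by (rule obtain_chart)
  let ?\<phi> = "local_map c f c'" and ?\<psi> = "local_map c' g d"
  let ?D = "frechet_derivative ?\<phi> (at (cmap c x))"
  let ?E = "frechet_derivative ?\<psi> (at (cmap c' (f x)))"
  have xV: "cmap c x \<in> local_dom c f c'"
    using x(1) c'(2) by (auto simp: local_dom_def)
  have fxW: "cmap c' (f x) \<in> local_dom c' g d"
    using x(2) c'(2) by (auto simp: local_dom_def)
  have \<phi>x: "?\<phi> (cmap c x) = cmap c' (f x)"
    using is_chartD(4)[OF is_chart[OF c] x(1)] by (simp add: local_map_def)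
  have D: "(?\<phi> has_derivative ?D) (at (cmap c x))"
    using smooth_open_differentiable[OF smooth_mapD(2)[OF f(1) c c'(1)] xV]
    by (simp add: frechet_derivative_works)
  have E: "(?\<psi> has_derivative ?E) (at (?\<phi> (cmap c x)))"
    using smooth_open_differentiable[OF smooth_mapD(2)[OF g(1) c'(1) d] fxW]
    by (simp add: frechet_derivative_works \<phi>x)
  have "frechet_derivative (local_map c (g \<circ> f) d) (at (cmap c x))
      = frechet_derivative (?\<psi> \<circ> ?\<phi>) (at (cmap c x))"
    by (rule frechet_derivative_cong_open[OF smooth_openD(1)[OF smooth_mapD(2)[OF f(1) c c'(1)]] xV])
      (simp add: local_map_comp(1)[OF is_chart[OF c] is_chart[OF c'(1)]])
  also have "\<dots> = ?E \<circ> ?D"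
    by (rule frechet_derivative_eqI[OF diff_chain_at[OF D E]])
  finally have "frechet_derivative (local_map c (g \<circ> f) d) (at (cmap c x)) = ?E \<circ> ?D" .
  moreover have "\<omega> d (cmap d (g (f x))) (?E (?D u)) (?E (?D v)) = \<omega> c' (cmap c' (f x)) (?D u) (?D v)"
    using g(2) c'(1) d c'(2) x(2)
    unfolding preserves_form_def Let_def local_map_def[symmetric] by auto
  moreover have "\<omega> c' (cmap c' (f x)) (?D u) (?D v) = \<omega> c (cmap c x) u v"
    using f(2) c c' x(1)
    unfolding preserves_form_def Let_def local_map_def[symmetric] by auto
  ultimately show "\<omega> d (cmap d ((g \<circ> f) x))
      (frechet_derivative (local_map c (g \<circ> f) d) (at (cmap c x)) u)
      (frechet_derivative (local_map c (g \<circ> f) d) (at (cmap c x)) v) = \<omega> c (cmap c x) u v"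
    by simp
qed

lemma Symp_comp:
  assumes "f \<in> Symp A \<omega>" "g \<in> Symp A \<omega>"
  shows "g \<circ> f \<in> Symp A \<omega>"
  using assms
  by (auto simp: Symp_def o_inv_distrib intro: bij_comp smooth_map_comp preserves_form_comp)

section \<open>Right translations are continuous\<close>

lemma openin_Cinf_nbhd:
  assumes "smooth_map A f" "0 < \<epsilon>" "c \<in> A" "d \<in> A" "compact K" "K \<subseteq> cdom c" "f ` K \<subseteq> cdom d"
  shows "openin (Cinf_topology A) (Cinf_nbhd A f r \<epsilon> c d K)"
  unfolding Cinf_topology_def
  by (rule topology_generated_by_Basis) (use assms in blast)

lemma mem_Cinf_nbhd_iff:
  "g \<in> Cinf_nbhd A f r \<epsilon> c d K \<longleftrightarrow> smooth_map A g \<and> g ` K \<subseteq> cdom d \<and>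
     (\<forall>y\<in>cmap c ` K. \<forall>vs. set vs \<subseteq> Basis \<and> length vs \<le> r \<longrightarrow>
        norm (iter_dderiv vs (local_map c g d) y - iter_dderiv vs (local_map c f d) y) < \<epsilon>)"
  by (simp add: Cinf_nbhd_def local_map_def)

lemma topspace_Cinf: "topspace (Cinf_topology A) = {g. smooth_map A g}"
proof
  show "topspace (Cinf_topology A) \<subseteq> {g. smooth_map A g}"
    unfolding Cinf_topology_def topology_generated_by_topspace by (auto simp: mem_Cinf_nbhd_iff)
  show "{g. smooth_map A g} \<subseteq> topspace (Cinf_topology A)"
  proof
    fix g assume "g \<in> {g. smooth_map A g}"
    moreover obtain c where "c \<in> A" by (rule obtain_chart)
    \<comment> \<open>With empty \<open>K\<close> the conditions on the compact set are vacuous, so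
      this subbasic set contains every smooth map.\<close>
    ultimately have "openin (Cinf_topology A) (Cinf_nbhd A g 0 1 c c {})"
      "g \<in> Cinf_nbhd A g 0 1 c c {}"
      using openin_Cinf_nbhd[of g 1 c c "{}" 0] by (auto simp: mem_Cinf_nbhd_iff)
    then show "g \<in> topspace (Cinf_topology A)"
      using openin_subset by blast
  qed
qed

text \<open>The error at \<open>z\<close> splits into that of \<open>g0 \<circ> a\<close> against
  \<open>f\<close>, kept below some \<open>e < \<epsilon>\<close> near \<open>y\<close> by
  continuity, and that of \<open>g \<circ> a\<close> against \<open>g0 \<circ> a\<close>, kept below
  \<open>\<epsilon> - e\<close> by the chain rule bound. The domain condition is part of the
  conclusion because it yields the image condition in \<open>Cinf_nbhd\<close>.\<close>

lemma right_translation_local: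
  assumes a: "smooth_map A a" and g0: "smooth_map A g0" and f: "smooth_map A f"
    and c: "c \<in> A" and d: "d \<in> A"
    and y: "y \<in> local_dom c f d" "y \<in> local_dom c (g0 \<circ> a) d"
    and close: "\<And>vs. set vs \<subseteq> Basis \<Longrightarrow> length vs \<le> r \<Longrightarrow>
      norm (iter_dderiv vs (local_map c (g0 \<circ> a) d) y - iter_dderiv vs (local_map c f d) y) < \<epsilon>"
  shows "\<exists>s Q. 0 < s \<and> openin (Cinf_topology A) Q \<and> g0 \<in> Q \<and>
    (\<forall>g\<in>Q. \<forall>z\<in>ball y s. z \<in> local_dom c (g \<circ> a) d \<and>
      (\<forall>vs. set vs \<subseteq> Basis \<and> length vs \<le> r \<longrightarrow>
        norm (iter_dderiv vs (local_map c (g \<circ> a) d) z - iter_dderiv vs (local_map c f d) z) < \<epsilon>))"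
proof -
  note chc = is_chart[OF c]
  obtain c' where c': "c' \<in> A" "a (cinv c y) \<in> cdom c'"
    by (rule obtain_chart)
  note chc' = is_chart[OF c'(1)]
  define \<phi> where "\<phi> = local_map c a c'"
  define V where "V = local_dom c a c'"
  define E where "E = {vs :: 'e list. set vs \<subseteq> Basis \<and> length vs \<le> r}"
  have finE: "finite E"
    unfolding E_def by (rule finite_lists_length_le) simp
  have \<phi>: "smooth_open V \<phi>"
    unfolding V_def \<phi>_def by (rule smooth_mapD(2)[OF a c c'(1)])
  have comp: "local_map c' g d (\<phi> z) = local_map c (g \<circ> a) d z"
    "\<phi> z \<in> local_dom c' g d \<longleftrightarrow> z \<in> local_dom c (g \<circ> a) d" if "z \<in> V" for g z
    using local_map_comp[OF chc chc'] that by (simp_all add: V_def \<phi>_def)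
  let ?f = "local_map c f d" and ?h = "local_map c (g0 \<circ> a) d"
  have h: "smooth_open (local_dom c (g0 \<circ> a) d) ?h"
    by (rule smooth_mapD(2)[OF smooth_map_comp[OF a g0] c d])
  have fs: "smooth_open (local_dom c f d) ?f"
    by (rule smooth_mapD(2)[OF f c d])
  define U where "U = V \<inter> local_dom c (g0 \<circ> a) d \<inter> local_dom c f d"
  have "open U"
    unfolding U_def using smooth_openD(1)[OF \<phi>] smooth_openD(1)[OF h] smooth_openD(1)[OF fs] by blast
  have "y \<in> U"
    using y c'(2) mem_local_dom_iff[OF chc] by (simp add: U_def V_def)
  obtain e where e: "e < \<epsilon>" "\<And>vs. vs \<in> E \<Longrightarrow> norm (iter_dderiv vs ?h y - iter_dderiv vs ?f y) < e"
    using finite_less_dense[OF finE, of "\<lambda>vs. norm (iter_dderiv vs ?h y - iter_dderiv vs ?f y)" \<epsilon>]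
      close unfolding E_def by blast
  have "\<forall>\<^sub>F z in nhds y. norm (iter_dderiv vs ?h z - iter_dderiv vs ?f z) < e" if "vs \<in> E" for vs
  proof -
    let ?m = "\<lambda>z. norm (iter_dderiv vs ?h z - iter_dderiv vs ?f z)"
    have "isCont ?m y"
      by (intro continuous_intros smooth_open_continuous_at[OF h y(2)]
          smooth_open_continuous_at[OF fs y(1)])
    then have "filterlim ?m (nhds (?m y)) (nhds y)"
      unfolding isCont_def by (subst (asm) tendsto_at_iff_tendsto_nhds)
    from order_tendstoD(2)[OF this e(2)[OF that]] show ?thesis .
  qed
  then have "\<forall>\<^sub>F z in nhds y. z \<in> U \<and> (\<forall>vs\<in>E. norm (iter_dderiv vs ?h z - iter_dderiv vs ?f z) < e)"
    using finE \<open>open U\<close> \<open>y \<in> U\<close>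
    by (intro eventually_conj eventually_nhds_in_open eventually_ball_finite) auto
  then obtain s0 where s0: "s0 > 0" "\<And>z. dist z y < s0 \<Longrightarrow>
      z \<in> U \<and> (\<forall>vs\<in>E. norm (iter_dderiv vs ?h z - iter_dderiv vs ?f z) < e)"
    unfolding eventually_nhds_metric by blast
  \<comment> \<open>Half the radius, so that the closed ball, which is compact, still lies where the
    estimate holds.\<close>
  define s where "s = s0 / 2"
  let ?B = "cball y s"
  have s: "s > 0" "?B \<subseteq> U"
    "\<And>z vs. z \<in> ?B \<Longrightarrow> vs \<in> E \<Longrightarrow> norm (iter_dderiv vs ?h z - iter_dderiv vs ?f z) < e"
    using s0 by (auto simp: s_def dist_commute)
  \<comment> \<open>On this compact set \<open>g\<close> is to be compared with \<open>g0\<close>: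
    it lies in \<open>cdom c'\<close> and \<open>g0\<close> maps it into \<open>cdom d\<close>, as a
    subbasic neighbourhood demands.\<close>
  define L where "L = (\<lambda>z. a (cinv c z)) ` ?B"
  have BV: "?B \<subseteq> V"
    using s(2) by (auto simp: U_def)
  have Bmem: "z \<in> cimg c" "a (cinv c z) \<in> cdom c'" "g0 (a (cinv c z)) \<in> cdom d" if "z \<in> ?B" for z
  proof -
    have "z \<in> local_dom c a c'" "z \<in> local_dom c (g0 \<circ> a) d"
      using s(2) that by (auto simp: U_def V_def)
    then show "z \<in> cimg c" "a (cinv c z) \<in> cdom c'" "g0 (a (cinv c z)) \<in> cdom d"
      by (simp_all add: mem_local_dom_iff[OF chc])
  qed
  then have Bc: "?B \<subseteq> cimg c" by blast
  have "continuous_on ?B (\<lambda>z. a (cinv c z))"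
    using continuous_on_compose2[OF smooth_mapD(1)[OF a]
        continuous_on_subset[OF is_chartD(3)[OF chc] Bc]] by simp
  then have "compact L"
    unfolding L_def by (intro compact_continuous_image compact_cball)
  have Lc': "L \<subseteq> cdom c'"
    using Bmem(2) by (auto simp: L_def)
  have Ld: "g0 ` L \<subseteq> cdom d"
    using Bmem(3) by (auto simp: L_def)
  have \<phi>L: "\<phi> z \<in> cmap c' ` L" if "z \<in> ?B" for z
    unfolding L_def \<phi>_def local_map_def using that by (auto simp del: mem_cball)
  \<comment> \<open>The estimate of \<open>iter_dderiv_comp_bound\<close> as a predicate on the
    constant, so that constants can be chosen for all \<open>vs \<in> E\<close> at once.\<close>
  define bnd where "bnd vs C \<longleftrightarrow> C \<ge> 0 \<and> (\<forall>(H :: 'e \<Rightarrow> 'e) W z M.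
      smooth_open W H \<longrightarrow> z \<in> ?B \<longrightarrow> \<phi> z \<in> W \<longrightarrow>
      (\<forall>ws\<in>E. norm (iter_dderiv ws H (\<phi> z)) \<le> M) \<longrightarrow>
      norm (iter_dderiv vs (H \<circ> \<phi>) z) \<le> C * M)" for vs C
  have "\<exists>C. bnd vs C" if vs: "vs \<in> E" for vs
  proof -
    obtain C where C: "C \<ge> 0" "\<forall>(H :: 'e \<Rightarrow> 'e) W x M. smooth_open W H \<longrightarrow> x \<in> ?B \<longrightarrow> \<phi> x \<in> W \<longrightarrow>
        (\<forall>ws. set ws \<subseteq> Basis \<and> length ws \<le> length vs \<longrightarrow> norm (iter_dderiv ws H (\<phi> x)) \<le> M) \<longrightarrow>
        norm (iter_dderiv vs (H \<circ> \<phi>) x) \<le> C * M"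
      using iter_dderiv_comp_bound[OF \<phi> compact_cball BV, where 'c = 'e and vs = vs] by (elim exE conjE) (rule that)
    have "bnd vs C"
      unfolding bnd_def
    proof (intro conjI allI impI C(1))
      fix H :: "'e \<Rightarrow> 'e" and W z M
      assume H: "smooth_open W H" "z \<in> ?B" "\<phi> z \<in> W" "\<forall>ws\<in>E. norm (iter_dderiv ws H (\<phi> z)) \<le> M"
      have "\<forall>ws. set ws \<subseteq> Basis \<and> length ws \<le> length vs \<longrightarrow> norm (iter_dderiv ws H (\<phi> z)) \<le> M"
        using H(4) vs by (simp add: E_def)
      then show "norm (iter_dderiv vs (H \<circ> \<phi>) z) \<le> C * M"
        using C(2)[rule_format, OF H(1-3)] by blast
    qed
    then show ?thesis ..
  qed
  then obtain C where bnd: "\<forall>vs\<in>E. bnd vs (C vs)"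
    using bchoice[of E bnd] by blast
  have C: "C vs \<ge> 0" if "vs \<in> E" for vs
    using bnd that by (simp add: bnd_def)
  \<comment> \<open>Chosen so that \<open>C vs * \<delta> < \<epsilon> - e\<close> for every
    \<open>vs \<in> E\<close>; the summand 1 keeps the denominator positive and the inequality
    strict.\<close>
  define \<delta> where "\<delta> = (\<epsilon> - e) / (sum C E + 1)"
  have sumC: "sum C E \<ge> 0"
    using C by (rule sum_nonneg)
  then have \<delta>: "\<delta> > 0"
    using e(1) by (simp add: \<delta>_def)
  have C\<delta>: "C vs * \<delta> < \<epsilon> - e" if "vs \<in> E" for vs
  proof -
    have "C vs \<le> sum C E"
      using that C finE by (intro member_le_sum) auto
    then have "C vs * \<delta> \<le> sum C E * \<delta>"
      using \<delta> by (intro mult_right_mono) auto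
    also have "\<dots> < (sum C E + 1) * \<delta>"
      using \<delta> by simp
    also have "\<dots> = \<epsilon> - e"
      using sumC by (simp add: \<delta>_def)
    finally show ?thesis .
  qed
  define Q where "Q = Cinf_nbhd A g0 r \<delta> c' d L"
  have "openin (Cinf_topology A) Q"
    unfolding Q_def by (rule openin_Cinf_nbhd) fact+
  moreover have "g0 \<in> Q"
    using g0 Ld \<delta> by (simp add: Q_def mem_Cinf_nbhd_iff)
  moreover have "z \<in> local_dom c (g \<circ> a) d \<and> (\<forall>vs. set vs \<subseteq> Basis \<and> length vs \<le> r \<longrightarrow>
      norm (iter_dderiv vs (local_map c (g \<circ> a) d) z - iter_dderiv vs ?f z) < \<epsilon>)"
    if "g \<in> Q" and "z \<in> ball y s" for g z
  proof -
    have zB: "z \<in> ?B" using that(2) by simp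
    then have zV: "z \<in> V" and zc: "z \<in> cimg c" and zU: "z \<in> U" using BV Bc s(2) by auto
    have g: "smooth_map A g" and gL: "g ` L \<subseteq> cdom d"
      and gclose: "\<And>ws. ws \<in> E \<Longrightarrow> norm (iter_dderiv ws (local_map c' g d) (\<phi> z)
        - iter_dderiv ws (local_map c' g0 d) (\<phi> z)) < \<delta>"
      using that(1) \<phi>L[OF zB] by (auto simp: Q_def mem_Cinf_nbhd_iff E_def)
    \<comment> \<open>Here the image condition of the neighbourhood enters:
      \<open>a (cinv c z)\<close> lies in \<open>L\<close>, which \<open>g\<close> maps into
      \<open>cdom d\<close>.\<close>
    have zga: "z \<in> local_dom c (g \<circ> a) d"
      using zB zc gL by (auto simp: L_def mem_local_dom_iff[OF chc] simp del: mem_cball)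
    have zh: "z \<in> local_dom c (g0 \<circ> a) d"
      using zU by (simp add: U_def)
    \<comment> \<open>Near \<open>z\<close>, the composite \<open>?H \<circ> \<phi>\<close> is the
      difference of the local expressions of \<open>g \<circ> a\<close> and
      \<open>g0 \<circ> a\<close>, while \<open>g \<in> Q\<close> bounds the derivatives of
      \<open>?H\<close> at \<open>\<phi> z\<close>.\<close>
    let ?H = "\<lambda>w. local_map c' g d w - local_map c' g0 d w"
    let ?W = "local_dom c' g d \<inter> local_dom c' g0 d"
    let ?k = "local_map c (g \<circ> a) d"
    note sg = smooth_mapD(2)[OF g c'(1) d] and sg0 = smooth_mapD(2)[OF g0 c'(1) d]
    note sk = smooth_mapD(2)[OF smooth_map_comp[OF a g] c d]
    have opW: "open ?W"
      using smooth_openD(1)[OF sg] smooth_openD(1)[OF sg0] by blast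
    have sgW: "smooth_open ?W (local_map c' g d)" "smooth_open ?W (local_map c' g0 d)"
      using smooth_open_subset[OF sg opW] smooth_open_subset[OF sg0 opW] by auto
    have H: "smooth_open ?W ?H"
      by (rule smooth_open_diff[OF sgW])
    have \<phi>zW: "\<phi> z \<in> ?W"
      using comp(2)[OF zV] zga zh by blast
    have HM: "\<forall>ws\<in>E. norm (iter_dderiv ws ?H (\<phi> z)) \<le> \<delta>"
      using gclose iter_dderiv_diff[OF sgW \<phi>zW] by (simp add: less_imp_le)
    have "norm (iter_dderiv vs ?k z - iter_dderiv vs ?f z) < \<epsilon>" if vs: "vs \<in> E" for vs
    proof -
      let ?Z = "local_dom c (g \<circ> a) d \<inter> local_dom c (g0 \<circ> a) d"
      have opZ: "open ?Z"
        using smooth_openD(1)[OF sk] smooth_openD(1)[OF h] by blast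
      have "iter_dderiv vs (?H \<circ> \<phi>) z = iter_dderiv vs (\<lambda>w. ?k w - ?h w) z"
        by (rule iter_dderiv_cong_open[OF open_Int_vimage_smooth[OF \<phi> opW]])
          (use comp(1) zV \<phi>zW in auto)
      also have "\<dots> = iter_dderiv vs ?k z - iter_dderiv vs ?h z"
        by (rule iter_dderiv_diff[OF smooth_open_subset[OF sk opZ] smooth_open_subset[OF h opZ]])
          (use zga zh in auto)
      finally have "norm (iter_dderiv vs ?k z - iter_dderiv vs ?h z) \<le> C vs * \<delta>"
        using bspec[OF bnd vs, unfolded bnd_def, THEN conjunct2, rule_format, OF H zB \<phi>zW] HM by simp
      moreover have "norm (iter_dderiv vs ?k z - iter_dderiv vs ?f z) \<le>
          norm (iter_dderiv vs ?k z - iter_dderiv vs ?h z) + norm (iter_dderiv vs ?h z - iter_dderiv vs ?f z)"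
        using norm_triangle_ineq[of "iter_dderiv vs ?k z - iter_dderiv vs ?h z"
            "iter_dderiv vs ?h z - iter_dderiv vs ?f z"] by simp
      ultimately show ?thesis
        using C\<delta>[OF vs] s(3)[OF zB vs] by linarith
    qed
    then show ?thesis
      using zga by (simp add: E_def)
  qed
  ultimately show ?thesis
    using s(1) by (intro exI[of _ s] exI[of _ Q]) blast
qed

text \<open>It is enough to treat preimages of subbasic sets. Near \<open>g0\<close>, the local
  estimate at each point of the compact image of \<open>K\<close> in the chart gives a ball and an
  open set of maps; a finite subcover by balls leaves a finite intersection of open sets.\<close>

lemma continuous_map_right_translation:
  assumes a: "smooth_map A a"
  shows "continuous_map (Cinf_topology A) (Cinf_topology A) (\<lambda>g. g \<circ> a)"
proof -
  let ?X = "Cinf_topology A"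
  let ?S = "{Cinf_nbhd A f r \<epsilon> c d K | f r \<epsilon> c d K. smooth_map A f \<and> 0 < \<epsilon> \<and> c \<in> A \<and> d \<in> A \<and>
    compact K \<and> K \<subseteq> cdom c \<and> f ` K \<subseteq> cdom d}"
  have "continuous_map ?X (topology_generated_by ?S) (\<lambda>g. g \<circ> a)"
  proof (rule continuous_on_generated_topo)
    have "(\<lambda>g. g \<circ> a) ` topspace ?X \<subseteq> topspace ?X"
      using smooth_map_comp[OF a] by (auto simp: topspace_Cinf)
    then show "(\<lambda>g. g \<circ> a) ` topspace ?X \<subseteq> \<Union> ?S"
      by (simp add: Cinf_topology_def)
    fix N assume "N \<in> ?S"
    then obtain f r \<epsilon> c d K where N: "N = Cinf_nbhd A f r \<epsilon> c d K"
      and f: "smooth_map A f" and c: "c \<in> A" and d: "d \<in> A"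
      and K: "compact K" "K \<subseteq> cdom c" "f ` K \<subseteq> cdom d"
      by blast
    note chc = is_chart[OF c]
    show "openin ?X ((\<lambda>g. g \<circ> a) -` N \<inter> topspace ?X)"
    proof (subst openin_subopen, intro ballI)
      fix g0 assume "g0 \<in> (\<lambda>g. g \<circ> a) -` N \<inter> topspace ?X"
      then have g0: "smooth_map A g0" and g0a: "(g0 \<circ> a) ` K \<subseteq> cdom d"
        and close: "\<And>y vs. y \<in> cmap c ` K \<Longrightarrow> set vs \<subseteq> Basis \<Longrightarrow> length vs \<le> r \<Longrightarrow>
          norm (iter_dderiv vs (local_map c (g0 \<circ> a) d) y - iter_dderiv vs (local_map c f d) y) < \<epsilon>"
        by (auto simp: topspace_Cinf N mem_Cinf_nbhd_iff)
      let ?P = "\<lambda>y s Q. 0 < s \<and> openin ?X Q \<and> g0 \<in> Q \<and>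
        (\<forall>g\<in>Q. \<forall>z\<in>ball y s. z \<in> local_dom c (g \<circ> a) d \<and>
          (\<forall>vs. set vs \<subseteq> Basis \<and> length vs \<le> r \<longrightarrow>
            norm (iter_dderiv vs (local_map c (g \<circ> a) d) z - iter_dderiv vs (local_map c f d) z) < \<epsilon>))"
      have "\<forall>y\<in>cmap c ` K. \<exists>s Q. ?P y s Q"
      proof
        fix y assume y: "y \<in> cmap c ` K"
        then obtain x where x: "y = cmap c x" "x \<in> K" ..
        have xd: "x \<in> cdom c \<inter> f -` cdom d" "x \<in> cdom c \<inter> (g0 \<circ> a) -` cdom d"
          using K g0a x(2) by blast+
        have "y \<in> local_dom c f d" "y \<in> local_dom c (g0 \<circ> a) d"
          unfolding local_dom_def x(1) using imageI[OF xd(1)] imageI[OF xd(2)] .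
        then show "\<exists>s Q. ?P y s Q"
          by (rule right_translation_local[OF a g0 f c d]) (rule close[OF y])
      qed
      from bchoice[OF this] obtain s where "\<forall>y\<in>cmap c ` K. \<exists>Q. ?P y (s y) Q"
        by (elim exE) (rule that)
      from bchoice[OF this] obtain Q where Q: "\<forall>y\<in>cmap c ` K. ?P y (s y) (Q y)"
        by (elim exE) (rule that)
      note Qs = bspec[OF Q, THEN conjunct1]
      note Qo = bspec[OF Q, THEN conjunct2, THEN conjunct1]
      note Qg = bspec[OF Q, THEN conjunct2, THEN conjunct2, THEN conjunct1]
      note Qz = bspec[OF Q, THEN conjunct2, THEN conjunct2, THEN conjunct2]
      have Kc: "compact (cmap c ` K)"
        using continuous_on_subset[OF is_chartD(8)[OF chc] K(2)] K(1)
        by (rule compact_continuous_image)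
      have cov: "cmap c ` K \<subseteq> (\<Union>y\<in>cmap c ` K. ball y (s y))"
      proof
        fix y assume y: "y \<in> cmap c ` K"
        then have "0 < s y" by (rule Qs)
        then have "y \<in> ball y (s y)" by simp
        with y show "y \<in> (\<Union>y\<in>cmap c ` K. ball y (s y))" by blast
      qed
      obtain Y where Y: "Y \<subseteq> cmap c ` K" "finite Y" "cmap c ` K \<subseteq> (\<Union>y\<in>Y. ball y (s y))"
        by (rule compactE_image[OF Kc _ cov, OF open_ball]) (rule that)
      \<comment> \<open>The whole space is included so that the family is nonempty and the
        intersection consists of smooth maps even when \<open>Y\<close> is empty.\<close>
      let ?R = "\<Inter> (insert (topspace ?X) (Q ` Y))"
      have "openin ?X ?R"
      proof (rule openin_Inter)
        show "finite (insert (topspace ?X) (Q ` Y))" using Y(2) by simp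
        show "openin ?X T" if "T \<in> insert (topspace ?X) (Q ` Y)" for T
          using that
        proof
          assume "T \<in> Q ` Y"
          then obtain y where "y \<in> Y" "T = Q y" ..
          then show ?thesis using Qo[OF subsetD[OF Y(1)]] by simp
        qed simp
      qed simp
      moreover have "g0 \<in> ?R"
      proof (intro InterI)
        fix T assume "T \<in> insert (topspace ?X) (Q ` Y)"
        then show "g0 \<in> T"
        proof
          assume "T \<in> Q ` Y"
          then obtain y where "y \<in> Y" "T = Q y" ..
          then show ?thesis using Qg[OF subsetD[OF Y(1)]] by simp
        qed (simp add: topspace_Cinf g0)
      qed
      moreover have "?R \<subseteq> (\<lambda>g. g \<circ> a) -` N \<inter> topspace ?X"
      proof
        fix g assume g: "g \<in> ?R"
        have sg: "smooth_map A g"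
          using InterD[OF g insertI1] unfolding topspace_Cinf by (rule CollectD)
        have *: "z \<in> local_dom c (g \<circ> a) d \<and> (\<forall>vs. set vs \<subseteq> Basis \<and> length vs \<le> r \<longrightarrow>
            norm (iter_dderiv vs (local_map c (g \<circ> a) d) z - iter_dderiv vs (local_map c f d) z) < \<epsilon>)"
          if "z \<in> cmap c ` K" for z
        proof -
          from subsetD[OF Y(3) that] obtain y where y: "y \<in> Y" "z \<in> ball y (s y)" ..
          have "g \<in> Q y" by (rule InterD[OF g insertI2[OF imageI[OF y(1)]]])
          from bspec[OF bspec[OF Qz[OF subsetD[OF Y(1) y(1)]] this] y(2)] show ?thesis .
        qed
        have "(g \<circ> a) x \<in> cdom d" if "x \<in> K" for x
        proof -
          have "cinv c (cmap c x) = x"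
            using that K(2) is_chartD(4)[OF chc] by blast
          then show ?thesis
            using *[OF imageI[OF that], THEN conjunct1] by (simp add: mem_local_dom_iff[OF chc])
        qed
        then have "(g \<circ> a) ` K \<subseteq> cdom d" by blast
        then have "g \<circ> a \<in> N"
          unfolding N mem_Cinf_nbhd_iff
          by (intro conjI ballI smooth_map_comp[OF a sg] *[THEN conjunct2])
        then show "g \<in> (\<lambda>g. g \<circ> a) -` N \<inter> topspace ?X"
          using sg by (simp add: topspace_Cinf)
      qed
      ultimately show "\<exists>T. openin ?X T \<and> g0 \<in> T \<and> T \<subseteq> (\<lambda>g. g \<circ> a) -` N \<inter> topspace ?X"
        by (intro exI[of _ ?R] conjI)
    qed
  qed
  then show ?thesis by (simp add: Cinf_topology_def)
qed

text \<open>The translate of the identity component by one of its elements \<open>f\<close> is connected and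
  contains \<open>f\<close>, so it lies in the component.\<close>

lemma Symp0_comp:
  assumes f: "f \<in> Symp0 A \<omega>" and g: "g \<in> Symp0 A \<omega>"
  shows "g \<circ> f \<in> Symp0 A \<omega>"
proof -
  let ?X = "Cinf_topology A" and ?Y = "subtopology (Cinf_topology A) (Symp A \<omega>)"
  have conn: "connectedin ?X (Symp0 A \<omega>)" "Symp0 A \<omega> \<subseteq> Symp A \<omega>"
    using connectedin_connected_component_of[of ?Y id]
    by (auto simp: connectedin_subtopology Symp0_def)
  then have fS: "f \<in> Symp A \<omega>" using f by blast
  have "smooth_map A f" using fS by (simp add: Symp_def)
  then have "connectedin ?X ((\<lambda>g. g \<circ> f) ` Symp0 A \<omega>)"
    using connectedin_continuous_map_image[OF continuous_map_right_translation conn(1)] by blast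
  moreover have "(\<lambda>g. g \<circ> f) ` Symp0 A \<omega> \<subseteq> Symp A \<omega>"
    using Symp_comp[OF fS] conn(2) by blast
  ultimately have "connectedin ?Y ((\<lambda>g. g \<circ> f) ` Symp0 A \<omega>)"
    by (simp add: connectedin_subtopology)
  \<comment> \<open>The component of a point outside the space is empty; as this one contains
    \<open>f\<close>, the point \<open>id\<close> belongs to it.\<close>
  moreover have "id \<in> Symp0 A \<omega>"
    using f by (metis Symp0_def connected_component_of_equiv connected_component_of_refl mem_Collect_eq)
  then have "f \<in> (\<lambda>g. g \<circ> f) ` Symp0 A \<omega>"
    by (intro image_eqI[of _ _ id]) auto
  ultimately have "(\<lambda>g. g \<circ> f) ` Symp0 A \<omega> \<subseteq> connected_component_of_set ?Y f"
    by (rule connected_component_of_maximal)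
  also have "\<dots> = Symp0 A \<omega>"
    using f unfolding Symp0_def by (metis connected_component_of_equiv mem_Collect_eq)
  finally show ?thesis using g by blast
qed

end

section \<open>Commutators and bi-invariant metrics\<close>

text \<open>The last hypothesis describes the commutator without inverses, so that \<open>D\<close>
  is applied only to products of elements of \<open>G\<close>. Invariance on both sides is what
  makes \<open>f \<circ> \<phi>\<close> and \<open>\<phi> \<circ> f\<close> equally far from
  \<open>f\<close>.\<close>

lemma bi_invariant_commutator_le:
  assumes D: "bi_invariant_metric G D"
    and G: "\<And>f g. f \<in> G \<Longrightarrow> g \<in> G \<Longrightarrow> g \<circ> f \<in> G"
    and mem: "id \<in> G" "\<phi> \<in> G" "f \<in> G" "g \<in> G"
    and g: "g \<circ> f \<circ> \<phi> = \<phi> \<circ> f"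
  shows "D id g \<le> 2 * D id \<phi>"
proof -
  interpret Metric_space G D
    using D by (simp add: bi_invariant_metric_def)
  have left: "D (\<theta> \<circ> \<alpha>) (\<theta> \<circ> \<beta>) = D \<alpha> \<beta>" and right: "D (\<alpha> \<circ> \<theta>) (\<beta> \<circ> \<theta>) = D \<alpha> \<beta>"
    if "\<alpha> \<in> G" "\<beta> \<in> G" "\<theta> \<in> G" for \<alpha> \<beta> \<theta>
    using D that by (auto simp: bi_invariant_metric_def)
  have "D id g = D f (g \<circ> f)"
    using right[of id g f] mem by simp
  also have "\<dots> = D (f \<circ> \<phi>) (\<phi> \<circ> f)"
    using right[of f "g \<circ> f" \<phi>] mem G g by simp
  also have "\<dots> \<le> D (f \<circ> \<phi>) f + D f (\<phi> \<circ> f)"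
    using mem G by (intro triangle)
  also have "D (f \<circ> \<phi>) f = D id \<phi>"
    using left[of \<phi> id f] mem commute[of \<phi> id] by simp
  also have "D f (\<phi> \<circ> f) = D id \<phi>"
    using right[of id \<phi> f] mem by simp
  finally show ?thesis by linarith
qed

theorem theorem1p3:
  fixes A :: "('m::{t2_space, second_countable_topology}, 'e::euclidean_space) chart set"
    and \<omega> :: "('m, 'e) local_2form"
  assumes "closed_symplectic_manifold A \<omega>"
    and "\<exists>\<phi>\<in>Symp0 A \<omega>.
           (SUP f\<in>Ham A \<omega>. ereal (Hofer_norm A \<omega> (\<phi> \<circ> f \<circ> inv \<phi> \<circ> inv f))) = \<infinity>"
  shows "\<not> extends_bi_invariantly (Ham A \<omega>) (Hofer_dist A \<omega>) (Symp0 A \<omega>)"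
proof
  interpret charted A
    by standard (use assms(1) in \<open>auto simp: closed_symplectic_manifold_def smooth_atlas_def\<close>)
  assume "extends_bi_invariantly (Ham A \<omega>) (Hofer_dist A \<omega>) (Symp0 A \<omega>)"
  then obtain D where D: "bi_invariant_metric (Symp0 A \<omega>) D"
    and ext: "\<And>f g. f \<in> Ham A \<omega> \<Longrightarrow> g \<in> Ham A \<omega> \<Longrightarrow> D f g = Hofer_dist A \<omega> f g"
    unfolding extends_bi_invariantly_def by blast
  obtain \<phi> where \<phi>: "\<phi> \<in> Symp0 A \<omega>"
    and unbounded: "(SUP f\<in>Ham A \<omega>. ereal (Hofer_norm A \<omega> (\<phi> \<circ> f \<circ> inv \<phi> \<circ> inv f))) = \<infinity>"
    using assms(2) by blast
  have bij: "bij f" if "f \<in> Symp0 A \<omega>" for f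
    using that connected_component_of_subset_topspace[of "subtopology (Cinf_topology A) (Symp A \<omega>)" id]
    by (auto simp: Symp0_def Symp_def)
  \<comment> \<open>The first entry bounds the norm through \<open>D\<close> when a path from
    \<open>id\<close> to the commutator exists; the second is the value of \<open>Hofer_dist\<close>
    when there is none.\<close>
  define B where "B = max (2 * D id \<phi>) (Inf {})"
  have "Hofer_norm A \<omega> (\<phi> \<circ> f \<circ> inv \<phi> \<circ> inv f) \<le> B" if f: "f \<in> Ham A \<omega>" for f
  proof -
    let ?g = "\<phi> \<circ> f \<circ> inv \<phi> \<circ> inv f"
    have f0: "f \<in> Symp0 A \<omega>" using f by (simp add: Ham_def)
    have eq: "?g \<circ> f \<circ> \<phi> = \<phi> \<circ> f"
      using bij_is_inj[OF bij[OF f0]] bij_is_inj[OF bij[OF \<phi>]] by (simp add: fun_eq_iff)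
    show ?thesis
    proof (cases "\<exists>F h. Ham_path A \<omega> F h \<and> h 0 = id \<and> h 1 = ?g")
      case True
      then obtain F h where "Ham_path A \<omega> F h" "h 0 = id" "h 1 = ?g" by blast
      \<comment> \<open>Both endpoints lie in \<open>Ham\<close> because \<open>Ham_path\<close>
        demands this of every \<open>h t\<close>; hence they lie in \<open>Symp0\<close>, and
        \<open>ext\<close> applies to the pair.\<close>
      then have Ham: "id \<in> Ham A \<omega>" "?g \<in> Ham A \<omega>"
        unfolding Ham_path_def by (metis atLeastAtMost_iff order_refl zero_le_one)+
      then have "id \<in> Symp0 A \<omega>" "?g \<in> Symp0 A \<omega>" by (simp_all add: Ham_def)
      then have "D id ?g \<le> 2 * D id \<phi>"
        using bi_invariant_commutator_le[OF D Symp0_comp _ \<phi> f0 _ eq] by blast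
      then show ?thesis
        using ext[OF Ham] by (simp add: Hofer_norm_def B_def)
    next
      case False \<comment> \<open>the norm is the junk value \<open>Inf {}\<close>, the same real number for every \<open>f\<close>\<close>
      then have "{Hofer_length F | F h. Ham_path A \<omega> F h \<and> h 0 = id \<and> h 1 = ?g} = {}"
        by blast
      then show ?thesis
        unfolding Hofer_norm_def Hofer_dist_def B_def by (simp only: max.cobounded2)
    qed
  qed
  then have "(SUP f\<in>Ham A \<omega>. ereal (Hofer_norm A \<omega> (\<phi> \<circ> f \<circ> inv \<phi> \<circ> inv f))) \<le> ereal B"
    by (intro SUP_least) simp
  then show False using unbounded by simp
qed

end
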